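(* For every $N\ge1$ and every partition $\mu$, the $N$-variate function $\widetilde H_{\mu|N}(u_1,\dots,u_N;q,t)\in\mathbb F[[u_1^{-1},\dots,u_N^{-1}]]$ is a rational function, i.e. it is the expansion of an element of $\mathbb F(u_1,\dots,u_N)$.
   Context: General notation. $\mathbb F=\mathbb Q(q,t)$ with $q,t$ formal variables; $\mathbb Y$ is the set of partitions, $\ell(\mu)$ the number of nonzero parts, $|\mu|$ the size, $\mathbb Y(N)=\{\mu\in\mathbb Y:\ell(\mu)\le N\}$. $\mathrm{Sym}_{\mathbb F}$ is the algebra of symmetric functions over $\mathbb F$, $p_n$ the power sums, $\mathrm{Sym}_{\mathbb F}(N)$ the algebra of symmetric polynomials in $N$ variables over $\mathbb F$. $P_{\mu|N}(x_1,\dots,x_N;q,t)$ are the Macdonald polynomials (Macdonald's book, Ch. VI), and $\langle p_\lambda,p_\mu\rangle_{q,t}=\delta_{\lambda\mu}z_\lambda\prod_{i}\frac{1-q^{\lambda_i}}{1-t^{\lambda_i}}$ is the Macdonald scalar product. $(z;q)_\infty=\prod_{n\ge0}(1-zq^n)$ is regarded as a power series in $z$ over $\mathbb Q(q)$, namely $\exp\bigl(-\sum_{m\ge1}\frac1m\frac{z^m}{1-q^m}\bigr)$. Interpolation functions. For $\lambda\in\mathbb Y(N)$ put $X_N(\lambda)=(q^{-\lambda_1},q^{-\lambda_2}t,\dots,q^{-\lambda_N}t^{N-1})$. For $\mu\in\mathbb Y(N)$, $I_{\mu|N}(\cdot;q,t)\in\mathrm{Sym}_{\mathbb F}(N)$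 is the unique symmetric polynomial of degree $|\mu|$ that vanishes at $X_N(\lambda)$ for all $\lambda\in\mathbb Y(N)$ with $\lambda\ne\mu$, $|\lambda|\le|\mu|$, and whose top-degree homogeneous component is $P_{\mu|N}(\cdot;q,t)$. Let $\phi_N:\mathrm{Sym}_{\mathbb F}\to\mathrm{Sym}_{\mathbb F}(N)$ be the algebra morphism with $\phi_N(p_n)=x_1^n+\dots+x_N^n+\frac{t^{Nn}}{1-t^n}$. $I_\mu(\cdot;q,t)\in\mathrm{Sym}_{\mathbb F}$ is the unique element with $\phi_N(I_\mu)=I_{\mu|N}$ for all $N\ge\ell(\mu)$. These elements form a basis of $\mathrm{Sym}_{\mathbb F}$. Dual functions. $\widehat{\mathrm{Sym}}_{\mathbb F}$ is the completion of $\mathrm{Sym}_{\mathbb F}$ consisting of symmetric formal power series in $y_1,y_2,\dots$ of possibly unbounded degree; $\langle\cdot,\cdot\rangle_{q,t}$ extends to a pairing of $\mathrm{Sym}_{\mathbb F}$ with $\widehat{\mathrm{Sym}}_{\mathbb F}$. The dual functions $H_\mu(\cdot;q,t)\in\widehat{\mathrm{Sym}}_{\mathbb F}$ are defined by $\langle I_\mu,H_\nu\rangle_{q,t}=\delta_{\mu\nu}$. $H_{\mu|N}(y_1,\dots,y_N;q,t)$ is the image of $H_\mu$ under $y_{N+1}=y_{N+2}=\dots=0$, and $\widetilde H_{\mu|N}(u_1,\dots,u_N;q,t)=H_{\mu|N}(u_1^{-1},\dots,u_N^{-1};q,t)\prod_{j=1}^N(u_j^{-1};q)_\infty\in\mathbb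 F[[u_1^{-1},\dots,u_N^{-1}]]$. *)

theory Defs
  imports
    "HOL-Library.Poly_Mapping"
    "HOL-Library.Multiset"
    "HOL-Combinatorics.Permutations"
    "HOL-Computational_Algebra.Computational_Algebra"
begin

section \<open>The ground field\<close>

text \<open>The field \<open>\<rat>(q,t)\<close> is the fraction field of \<open>\<rat>[q][t]\<close>.\<close>

type_synonym qt = "rat poly poly fract"

definition q :: qt where "q = Fract [:[:0, 1:]:] 1"

definition t :: qt where "t = Fract [:0, 1:] 1"

section \<open>Partitions\<close>

text \<open>A partition is the weakly decreasing list of its nonzero parts, so \<open>length \<mu>\<close> is
  \<open>\<ell>(\<mu>)\<close> and \<open>sum_list \<mu>\<close> is \<open>|\<mu>|\<close>.\<close>

definition is_partition :: "nat list \<Rightarrow> bool" where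
  "is_partition \<mu> \<longleftrightarrow> sorted_wrt (\<ge>) \<mu> \<and> 0 \<notin> set \<mu>"

text \<open>Zero-based: \<open>part \<mu> i\<close> is \<open>\<mu>\<^sub>i\<^sub>+\<^sub>1\<close>, and \<open>0\<close> beyond the length.\<close>

definition part :: "nat list \<Rightarrow> nat \<Rightarrow> nat" where
  "part \<mu> i = (if i < length \<mu> then \<mu> ! i else 0)"

definition dominated :: "nat list \<Rightarrow> nat list \<Rightarrow> bool" where
  "dominated \<mu> \<kappa> \<longleftrightarrow> sum_list \<mu> = sum_list \<kappa> \<and>
     (\<forall>k. sum_list (take k \<mu>) \<le> sum_list (take k \<kappa>))"

definition z_part :: "nat list \<Rightarrow> nat" where
  "z_part \<mu> = (\<Prod>i\<in>set \<mu>. i ^ count_list \<mu> i * fact (count_list \<mu> i))"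

section \<open>Polynomials and power series in countably many variables\<close>

text \<open>Variables are numbered from \<open>0\<close>: \<open>x\<^sub>j\<close>, \<open>y\<^sub>j\<close>, \<open>u\<^sub>j\<close> (with \<open>j \<ge> 1\<close>) have number \<open>j - 1\<close>.\<close>

type_synonym monom = "nat \<Rightarrow>\<^sub>0 nat"

definition mdeg :: "monom \<Rightarrow> nat" where
  "mdeg m = (\<Sum>i\<in>Poly_Mapping.keys m. Poly_Mapping.lookup m i)"

subsection \<open>Polynomials\<close>

type_synonym 'a mpoly = "monom \<Rightarrow>\<^sub>0 'a"

definition mpoly_in :: "nat \<Rightarrow> 'a::zero mpoly set" where
  "mpoly_in N = {f. \<forall>m\<in>Poly_Mapping.keys f. Poly_Mapping.keys m \<subseteq> {..<N}}"

definition sym_mpoly :: "nat \<Rightarrow> 'a::zero mpoly set" where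
  "sym_mpoly N = {f \<in> mpoly_in N. \<forall>\<pi>. \<pi> permutes {..<N} \<longrightarrow>
     (\<forall>m. Poly_Mapping.lookup f (Poly_Mapping.map_key \<pi> m) = Poly_Mapping.lookup f m)}"

definition mpoly_degree :: "'a::zero mpoly \<Rightarrow> nat" where
  "mpoly_degree f = Max (insert 0 (mdeg ` Poly_Mapping.keys f))"

definition mpoly_eval :: "(nat \<Rightarrow> 'a) \<Rightarrow> 'a::comm_semiring_1 mpoly \<Rightarrow> 'a" where
  "mpoly_eval x f = (\<Sum>m\<in>Poly_Mapping.keys f. Poly_Mapping.lookup f m *
     (\<Prod>i\<in>Poly_Mapping.keys m. x i ^ Poly_Mapping.lookup m i))"

definition mpoly_const :: "'a::zero \<Rightarrow> 'a mpoly" where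
  "mpoly_const c = Poly_Mapping.single 0 c"

subsection \<open>Power series\<close>

typedef 'a mfps = "UNIV :: (monom \<Rightarrow> 'a) set"
  morphisms mcoeff Abs_mfps by simp

setup_lifting type_definition_mfps

lemma mfps_eqI: "(\<And>m. mcoeff f m = mcoeff g m) \<Longrightarrow> f = g"
  by (metis ext mcoeff_inject)

lemma mcoeff_Abs_mfps [simp]: "mcoeff (Abs_mfps c) = c"
  by (simp add: Abs_mfps_inverse)

lemma finite_monom_splittings: "finite {(a, b). a + b = (m::monom)}"
proof -
  let ?K = "Poly_Mapping.keys m"
  let ?k = "Max (insert 0 (Poly_Mapping.lookup m ` ?K))"
  let ?F = "{f. \<forall>x. (x \<in> ?K \<longrightarrow> f x \<in> {..?k}) \<and> (x \<notin> ?K \<longrightarrow> f x = (0::nat))}"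
  have fin: "finite ?F"
    by (rule finite_set_of_finite_funs) auto
  have le: "Poly_Mapping.lookup a x \<le> Poly_Mapping.lookup m x" if "a + b = m" for a b x
    using that by (metis lookup_add le_add1)
  have sub: "Poly_Mapping.lookup ` {a. \<exists>b. a + b = m} \<subseteq> ?F"
  proof clarify
    fix a b x assume ab: "m = a + b"
    have 1: "Poly_Mapping.lookup m x \<le> ?k" if "x \<in> ?K"
      using that by (intro Max_ge) auto
    have 2: "Poly_Mapping.lookup m x = 0" if "x \<notin> ?K"
      using that by (simp add: in_keys_iff)
    show "(x \<in> Poly_Mapping.keys (a + b) \<longrightarrow> Poly_Mapping.lookup a x \<in>
             {..Max (insert 0 (Poly_Mapping.lookup (a + b) ` Poly_Mapping.keys (a + b)))}) \<and>
          (x \<notin> Poly_Mapping.keys (a + b) \<longrightarrow> Poly_Mapping.lookup a x = 0)"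
      using le[OF ab[symmetric], of x] 1 2 unfolding ab
      by (metis atMost_iff le_trans le_zero_eq)
  qed
  have "inj_on Poly_Mapping.lookup {a. \<exists>b. a + b = m}"
    by (auto intro!: inj_onI poly_mapping_eqI)
  then have finA: "finite {a. \<exists>b. a + b = m}"
    using sub fin by (meson finite_imageD finite_subset)
  have "{(a, b). a + b = m} \<subseteq> (\<lambda>a. (a, m - a)) ` {a. \<exists>b. a + b = m}"
    by (auto simp: image_iff)
  then show ?thesis
    using finA by (meson finite_imageI finite_subset)
qed

instantiation mfps :: (comm_ring_1) comm_ring_1
begin

lift_definition zero_mfps :: "'a mfps" is "\<lambda>_. 0" .
lift_definition one_mfps :: "'a mfps" is "\<lambda>m. if m = 0 then 1 else 0" .
lift_definition plus_mfps :: "'a mfps \<Rightarrow> 'a mfps \<Rightarrow> 'a mfps" is "\<lambda>f g m. f m + g m" .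
lift_definition minus_mfps :: "'a mfps \<Rightarrow> 'a mfps \<Rightarrow> 'a mfps" is "\<lambda>f g m. f m - g m" .
lift_definition uminus_mfps :: "'a mfps \<Rightarrow> 'a mfps" is "\<lambda>f m. - f m" .
lift_definition times_mfps :: "'a mfps \<Rightarrow> 'a mfps \<Rightarrow> 'a mfps"
  is "\<lambda>f g m. \<Sum>(a, b)\<in>{(a, b). a + b = m}. f a * g b" .

instance
proof
  fix f g h :: "'a mfps"
  show "f + g + h = f + (g + h)" by transfer (auto simp: add.assoc)
  show "f + g = g + f" by transfer (auto simp: add.commute)
  show "0 + f = f" by transfer auto
  show "- f + f = 0" by transfer auto
  show "f - g = f + - g" by transfer auto
  show "(0::'a mfps) \<noteq> 1" by transfer (metis zero_neq_one)
  show "f * g = g * f"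
  proof transfer
    fix f g :: "monom \<Rightarrow> 'a"
    show "(\<lambda>m. \<Sum>(a, b)\<in>{(a, b). a + b = m}. f a * g b) =
          (\<lambda>m. \<Sum>(a, b)\<in>{(a, b). a + b = m}. g a * f b)"
      by (intro ext sum.reindex_bij_witness[of _ "\<lambda>(a, b). (b, a)" "\<lambda>(a, b). (b, a)"])
         (auto simp: add.commute mult.commute)
  qed
  show "(f + g) * h = f * h + g * h"
    by transfer (auto simp: sum.distrib[symmetric] distrib_right intro!: sum.cong)
  show "1 * f = f"
  proof transfer
    fix f :: "monom \<Rightarrow> 'a"
    have "(\<Sum>(a, b)\<in>{(a, b). a + b = m}. (if a = 0 then 1 else 0) * f b) = f m" for m
    proof -
      have "(\<Sum>(a, b)\<in>{(a, b). a + b = m}. (if a = 0 then 1 else 0) * f b) =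
            (\<Sum>(a, b)\<in>{(0::monom, m)}. (if a = 0 then 1 else 0) * f b)"
        by (rule sum.mono_neutral_right) (auto simp: finite_monom_splittings split: if_splits)
      then show ?thesis by simp
    qed
    then show "(\<lambda>m. \<Sum>(a, b)\<in>{(a, b). a + b = m}. (if a = 0 then 1 else 0) * f b) = f"
      by auto
  qed
  show "f * g * h = f * (g * h)"
  proof transfer
    fix f g h :: "monom \<Rightarrow> 'a"
    have "(\<Sum>(a, b)\<in>{(a, b). a + b = m}. (\<Sum>(c, d)\<in>{(c, d). c + d = a}. f c * g d) * h b) =
          (\<Sum>(a, b)\<in>{(a, b). a + b = m}. f a * (\<Sum>(c, d)\<in>{(c, d). c + d = b}. g c * h d))"
      (is "?l = ?r") for m
    proof -
      have "?l = (\<Sum>p\<in>{(a, b). a + b = m}. \<Sum>s\<in>{(c, d). c + d = fst p}.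
                    f (fst s) * g (snd s) * h (snd p))"
        by (simp add: sum_distrib_right case_prod_unfold)
      also have "\<dots> = (\<Sum>(p, s)\<in>(SIGMA p:{(a, b). a + b = m}. {(c, d). c + d = fst p}).
                    f (fst s) * g (snd s) * h (snd p))"
        by (rule sum.Sigma) (auto simp: finite_monom_splittings)
      also have "\<dots> = (\<Sum>(p, s)\<in>(SIGMA p:{(a, b). a + b = m}. {(c, d). c + d = snd p}).
                    f (fst p) * (g (fst s) * h (snd s)))"
        by (rule sum.reindex_bij_witness
             [of _ "\<lambda>((a, b), (c, d)). ((a + c, d), (a, c))" "\<lambda>((a, b), (c, d)). ((c, d + b), (d, b))"])
           (auto simp: add.assoc mult.assoc)
      also have "\<dots> = (\<Sum>p\<in>{(a, b). a + b = m}. \<Sum>s\<in>{(c, d). c + d = snd p}.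
                    f (fst p) * (g (fst s) * h (snd s)))"
        by (rule sum.Sigma[symmetric]) (auto simp: finite_monom_splittings)
      also have "\<dots> = ?r"
        by (simp add: sum_distrib_left case_prod_unfold)
      finally show ?thesis .
    qed
    then show "(\<lambda>m. \<Sum>(a, b)\<in>{(a, b). a + b = m}. (\<Sum>(c, d)\<in>{(c, d). c + d = a}. f c * g d) * h b) =
          (\<lambda>m. \<Sum>(a, b)\<in>{(a, b). a + b = m}. f a * (\<Sum>(c, d)\<in>{(c, d). c + d = b}. g c * h d))"
      by auto
  qed
qed

end

definition mfps_const :: "'a::zero \<Rightarrow> 'a mfps" where
  "mfps_const c = Abs_mfps (\<lambda>m. if m = 0 then c else 0)"

text \<open>The univariate series \<open>f\<close> in the variable number \<open>j\<close>.\<close>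

definition fps_in_var :: "nat \<Rightarrow> 'a::zero fps \<Rightarrow> 'a mfps" where
  "fps_in_var j f = Abs_mfps (\<lambda>m. if Poly_Mapping.keys m \<subseteq> {j}
     then fps_nth f (Poly_Mapping.lookup m j) else 0)"

text \<open>All variables except the first \<open>N\<close> are set to \<open>0\<close>.\<close>

definition restrict_vars :: "nat \<Rightarrow> 'a::zero mfps \<Rightarrow> 'a mfps" where
  "restrict_vars N f = Abs_mfps (\<lambda>m. if Poly_Mapping.keys m \<subseteq> {..<N} then mcoeff f m else 0)"

section \<open>Symmetric functions\<close>

definition Sym_hat :: "qt mfps set" where
  "Sym_hat = {f. \<forall>\<pi>. bij \<pi> \<longrightarrow> (\<forall>m. mcoeff f (Poly_Mapping.map_key \<pi> m) = mcoeff f m)}"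

definition Sym :: "qt mfps set" where
  "Sym = {f \<in> Sym_hat. \<exists>d. \<forall>m. mcoeff f m \<noteq> 0 \<longrightarrow> mdeg m \<le> d}"

definition mono_sym :: "nat list \<Rightarrow> qt mfps" where
  "mono_sym \<mu> = Abs_mfps (\<lambda>m.
     if image_mset (Poly_Mapping.lookup m) (mset_set (Poly_Mapping.keys m)) = mset \<mu> then 1 else 0)"

definition power_sum :: "nat \<Rightarrow> qt mfps" where
  "power_sum n = Abs_mfps (\<lambda>m. if \<exists>i. m = Poly_Mapping.single i n then 1 else 0)"

definition power_sums :: "nat list \<Rightarrow> qt mfps" where
  "power_sums \<kappa> = prod_list (map power_sum \<kappa>)"

text \<open>The coefficients \<open>c\<^sub>\<kappa>\<close> of \<open>f = \<Sum>\<^sub>\<kappa> c\<^sub>\<kappa> p\<^sub>\<kappa>\<close>. For \<open>f\<close> in the completion the sum may be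
  infinite; it converges degree by degree, since \<open>p\<^sub>\<kappa>\<close> is homogeneous of degree \<open>|\<kappa>|\<close>.
  For \<open>f\<close> in \<open>Sym\<close> only finitely many coefficients are nonzero.\<close>

definition p_coeffs :: "qt mfps \<Rightarrow> nat list \<Rightarrow> qt" where
  "p_coeffs f = (THE c. (\<forall>\<kappa>. \<not> is_partition \<kappa> \<longrightarrow> c \<kappa> = 0) \<and>
     (\<forall>m. mcoeff f m =
        (\<Sum>\<kappa> | is_partition \<kappa> \<and> sum_list \<kappa> = mdeg m. c \<kappa> * mcoeff (power_sums \<kappa>) m)))"

text \<open>The Macdonald pairing \<open>\<langle>f, g\<rangle>\<close> for \<open>f\<close> in \<open>Sym\<close> and \<open>g\<close> in the completion: the (continuous)
  bilinear extension of its values on the power sums.\<close>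

definition mac_pairing :: "qt mfps \<Rightarrow> qt mfps \<Rightarrow> qt" where
  "mac_pairing f g = (\<Sum>\<kappa> | p_coeffs f \<kappa> \<noteq> 0. p_coeffs f \<kappa> * p_coeffs g \<kappa> *
     (of_nat (z_part \<kappa>) * (\<Prod>k\<leftarrow>\<kappa>. (1 - q ^ k) / (1 - t ^ k))))"

text \<open>The Macdonald symmetric functions \<open>P\<^sub>\<kappa>(\<cdot>;q,t)\<close> are the family determined by unitriangularity
  in the monomial symmetric functions with respect to the dominance order, and orthogonality.\<close>

definition macdonald_functions :: "(nat list \<Rightarrow> qt mfps) \<Rightarrow> bool" where
  "macdonald_functions P \<longleftrightarrow>
     (\<forall>\<kappa>. is_partition \<kappa> \<longrightarrow>
        (\<exists>c. P \<kappa> = mono_sym \<kappa> +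
           (\<Sum>\<mu> | is_partition \<mu> \<and> dominated \<mu> \<kappa> \<and> \<mu> \<noteq> \<kappa>. mfps_const (c \<mu>) * mono_sym \<mu>))) \<and>
     (\<forall>\<kappa> \<mu>. is_partition \<kappa> \<longrightarrow> is_partition \<mu> \<longrightarrow> \<kappa> \<noteq> \<mu> \<longrightarrow> mac_pairing (P \<kappa>) (P \<mu>) = 0)"

section \<open>Interpolation functions\<close>

definition X_point :: "nat list \<Rightarrow> nat \<Rightarrow> qt" where
  "X_point \<kappa> i = inverse q ^ part \<kappa> i * t ^ i"

text \<open>\<open>f\<close> is the interpolation polynomial \<open>I\<^sub>\<mu>\<^sub>|\<^sub>N\<close>; its top homogeneous component is
  \<open>P\<^sub>\<mu>(x\<^sub>1,\<dots>,x\<^sub>N)\<close>, where \<open>P\<close> is the family of Macdonald symmetric functions.\<close>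

definition interpolation_polynomial ::
    "(nat list \<Rightarrow> qt mfps) \<Rightarrow> nat \<Rightarrow> nat list \<Rightarrow> qt mpoly \<Rightarrow> bool" where
  "interpolation_polynomial P N \<mu> f \<longleftrightarrow>
     f \<in> sym_mpoly N \<and>
     mpoly_degree f = sum_list \<mu> \<and>
     (\<forall>\<kappa>. is_partition \<kappa> \<longrightarrow> length \<kappa> \<le> N \<longrightarrow> \<kappa> \<noteq> \<mu> \<longrightarrow> sum_list \<kappa> \<le> sum_list \<mu> \<longrightarrow>
        mpoly_eval (X_point \<kappa>) f = 0) \<and>
     (\<forall>m. mdeg m = sum_list \<mu> \<longrightarrow>
        Poly_Mapping.lookup f m = mcoeff (restrict_vars N (P \<mu>)) m)"

text \<open>The algebra morphism \<open>\<phi>\<^sub>N\<close>: since the \<open>p\<^sub>n\<close> are free generators of \<open>Sym\<close>, it is obtained by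
  substituting the images of the \<open>p\<^sub>n\<close> into the power sum expansion.\<close>

definition phi_power_sum :: "nat \<Rightarrow> nat \<Rightarrow> qt mpoly" where
  "phi_power_sum N n =
     (\<Sum>i<N. Poly_Mapping.single (Poly_Mapping.single i n) 1) + mpoly_const (t ^ (N * n) / (1 - t ^ n))"

definition phi :: "nat \<Rightarrow> qt mfps \<Rightarrow> qt mpoly" where
  "phi N f = (\<Sum>\<kappa> | p_coeffs f \<kappa> \<noteq> 0.
     mpoly_const (p_coeffs f \<kappa>) * prod_list (map (phi_power_sum N) \<kappa>))"

definition interpolation_functions ::
    "(nat list \<Rightarrow> qt mfps) \<Rightarrow> (nat list \<Rightarrow> qt mfps) \<Rightarrow> bool" where
  "interpolation_functions P I \<longleftrightarrow> (\<forall>\<mu>. is_partition \<mu> \<longrightarrow>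
     I \<mu> \<in> Sym \<and> (\<forall>N\<ge>length \<mu>. interpolation_polynomial P N \<mu> (phi N (I \<mu>))))"

section \<open>Dual functions\<close>

definition dual_functions ::
    "(nat list \<Rightarrow> qt mfps) \<Rightarrow> (nat list \<Rightarrow> qt mfps) \<Rightarrow> bool" where
  "dual_functions I H \<longleftrightarrow>
     (\<forall>\<nu>. is_partition \<nu> \<longrightarrow> H \<nu> \<in> Sym_hat) \<and>
     (\<forall>\<mu> \<nu>. is_partition \<mu> \<longrightarrow> is_partition \<nu> \<longrightarrow>
        mac_pairing (I \<mu>) (H \<nu>) = (if \<mu> = \<nu> then 1 else 0))"

text \<open>\<open>(z;q)\<^sub>\<infinity>\<close> as a power series in \<open>z\<close>.\<close>

definition q_pochhammer_inf :: "qt fps" where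
  "q_pochhammer_inf = fps_exp 1 oo
     (- Abs_fps (\<lambda>m. if m = 0 then 0 else 1 / (of_nat m * (1 - q ^ m))))"

text \<open>\<open>H_tilde N (H \<mu>)\<close> is the modified dual function, as a power series whose variable number
  \<open>j - 1\<close> is \<open>u\<^sub>j\<close> to the power \<open>-1\<close>.\<close>

definition H_tilde :: "nat \<Rightarrow> qt mfps \<Rightarrow> qt mfps" where
  "H_tilde N h = restrict_vars N h * (\<Prod>j<N. fps_in_var j q_pochhammer_inf)"

section \<open>Rational functions and their expansions\<close>

definition rational_functions :: "nat \<Rightarrow> qt mpoly fract set" where
  "rational_functions N = {Fract a b | a b. a \<in> mpoly_in N \<and> b \<in> mpoly_in N \<and> b \<noteq> 0}"

text \<open>The Laurent series \<open>b(u) h(u\<inverse>)\<close> in the inverses of the \<open>u\<^sub>j\<close>: its coefficient at the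
  monomial in the \<open>u\<^sub>j\<close> with exponents \<open>e\<close>.\<close>

definition laurent_product :: "'a::comm_ring_1 mpoly \<Rightarrow> 'a mfps \<Rightarrow> (nat \<Rightarrow> int) \<Rightarrow> 'a" where
  "laurent_product b h e =
     (\<Sum>m\<in>Poly_Mapping.keys b.
        \<Sum>n | \<forall>i. int (Poly_Mapping.lookup m i) - int (Poly_Mapping.lookup n i) = e i.
          Poly_Mapping.lookup b m * mcoeff h n)"

text \<open>The power series \<open>h\<close> in the inverses of the \<open>u\<^sub>j\<close> is the expansion of the rational function
  \<open>r = a / b\<close> of the \<open>u\<^sub>j\<close>, that is, \<open>b(u) h(u\<inverse>) = a(u)\<close>.\<close>

definition is_expansion_of :: "qt mfps \<Rightarrow> qt mpoly fract \<Rightarrow> bool" where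
  "is_expansion_of h r \<longleftrightarrow>
     (\<exists>a b. b \<noteq> 0 \<and> r = Fract a b \<and> laurent_product b h = laurent_product a 1)"

end

theory Submission
  imports Defs "Jordan_Normal_Form.Determinant"
begin

text \<open>For a partition \<open>\<eta>\<close>, evaluation at the infinite point \<open>(q^(-\<eta>\<^sub>1), q^(-\<eta>\<^sub>2) t, \<dots>)\<close> is an algebra
  morphism on \<open>Sym\<close>. As \<open>(I\<^sub>\<kappa>)\<close> and \<open>(H\<^sub>\<kappa>)\<close> are dual, evaluating the reproducing kernel of the Macdonald
  pairing there gives \<open>\<Sum>\<^sub>\<kappa> I\<^sub>\<kappa>(\<eta>) H\<^sub>\<kappa>(y) = K\<^sub>\<eta>(y)\<close>, and by the vanishing conditions only \<open>\<kappa> = \<eta>\<close> and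
  \<open>|\<kappa>| < |\<eta>|\<close> contribute. Moreover \<open>I\<^sub>\<eta>(\<eta>) \<noteq> 0\<close>: otherwise the evaluation at \<open>\<eta>\<close> would be a linear
  combination of the evaluations at smaller partitions, but finitely many morphisms that take distinct
  values at \<open>p\<^sub>1\<close> are linearly independent. So every \<open>H\<^sub>\<mu>\<close> is a finite linear combination of the
  \<open>K\<^sub>\<nu>\<close> with \<open>|\<nu>| \<le> |\<mu>|\<close>. Finally \<open>K\<^sub>\<nu>\<close> is a product over the variables, and multiplying the factor of \<open>y\<close>
  by \<open>(y;q)\<^sub>\<infinity>\<close> turns it into the finite product of \<open>(1 - t^i q^(-k) y) / (1 - t^(i-1) q^(-k) y)\<close> over the cells
  \<open>(i, k)\<close> of \<open>\<nu>\<close>.\<close>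

section \<open>Monomials and power series\<close>

text \<open>The kernel identity involves infinitely many series of unbounded degree, so it is read
  off one power sum coefficient at a time. On partitions of size at most d, the power sum
  coefficients of the I_\<kappa> and the weighted coefficients of the H_\<kappa> form square
  matrices. Duality says that the product of the two in one order is the identity; so is the product
  in the other order, and that is the kernel identity. The truncation requires I_\<kappa> itself to
  have degree at most |\<kappa>|, whereas the definition bounds only its images under phi_N; the
  degree is recovered by taking many variables. For H_\<mu> to be a combination of kernels, the
  constants must be the same for all power sum coefficients; this works because the vanishing
  conditions cut the sum over \<kappa> down to a finite set depending on \<eta> alone. The series
  (y;q)_inf is the reciprocal of the one-variable kernel of the empty partition, so multiplying by
  it leaves only the effect of the finitely many cells. Rationality is shown in y_j = 1/u_j and
  carried over to the u_j at the end.\<close>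

abbreviation lkp where "lkp \<equiv> Poly_Mapping.lookup"

lemma mcoeff_simps [simp]:
  "mcoeff 0 m = 0" "mcoeff 1 m = (if m = 0 then 1 else 0)"
  "mcoeff (f + g) m = mcoeff f m + mcoeff g m" "mcoeff (f - g) m = mcoeff f m - mcoeff g m"
  "mcoeff (- f) m = - mcoeff f m"
  by (simp_all add: zero_mfps.rep_eq one_mfps.rep_eq plus_mfps.rep_eq minus_mfps.rep_eq uminus_mfps.rep_eq)

lemmas mcoeff_mult = times_mfps.rep_eq

lemma mcoeff_sum: "mcoeff (sum f A) m = (\<Sum>x\<in>A. mcoeff (f x) m)"
  by (induction A rule: infinite_finite_induct) auto

lemma monom_diff_add_iff: "(\<exists>b. m = Poly_Mapping.single i n + b) \<longleftrightarrow> n \<le> lkp m (i::nat)" for m :: monom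
proof
  assume "n \<le> lkp m i"
  then have "m = Poly_Mapping.single i n + (m - Poly_Mapping.single i n)"
    by (intro poly_mapping_eqI) (auto simp: lookup_add lookup_minus lookup_single when_def)
  then show "\<exists>b. m = Poly_Mapping.single i n + b" by blast
qed (auto simp: lookup_add)

lemma single_add_diff:
  fixes m :: monom
  assumes "n \<le> lkp m i"
  shows "Poly_Mapping.single i n + (m - Poly_Mapping.single i n) = m"
  by (rule poly_mapping_eqI) (use assms in \<open>auto simp: lookup_add lookup_minus lookup_single when_def\<close>)

lemma mdeg_eq_sum:
  assumes "finite A" "Poly_Mapping.keys m \<subseteq> A"
  shows "mdeg m = (\<Sum>i\<in>A. lkp m i)"
  unfolding mdeg_def by (rule sum.mono_neutral_left) (use assms in \<open>auto simp: in_keys_iff\<close>)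

lemma mdeg_add [simp]: "mdeg (a + b) = mdeg a + mdeg b"
proof -
  let ?A = "Poly_Mapping.keys a \<union> Poly_Mapping.keys b"
  have "mdeg (a + b) = (\<Sum>i\<in>?A. lkp (a + b) i)"
    by (rule mdeg_eq_sum) (use Poly_Mapping.keys_add[of a b] in auto)
  also have "\<dots> = mdeg a + mdeg b"
    by (subst (1 2) mdeg_eq_sum[of ?A]) (auto simp: lookup_add sum.distrib)
  finally show ?thesis .
qed

lemma mdeg_single [simp]: "mdeg (Poly_Mapping.single i n) = n"
  by (simp add: mdeg_def)

lemma mdeg_zero [simp]: "mdeg 0 = 0"
  by (simp add: mdeg_def)

lemma mdeg_eq_0_iff [simp]: "mdeg m = 0 \<longleftrightarrow> m = 0"
  by (auto simp: mdeg_def in_keys_iff intro!: poly_mapping_eqI)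

lemma mdeg_diff_single:
  "n \<le> lkp m i \<Longrightarrow> mdeg (m - Poly_Mapping.single i n) = mdeg m - n"
  by (metis add_diff_cancel_left' mdeg_add mdeg_single single_add_diff)

lemma lookup_le_mdeg: "lkp m i \<le> mdeg m"
proof (cases "i \<in> Poly_Mapping.keys m")
  case True
  then show ?thesis unfolding mdeg_def by (intro member_le_sum) auto
qed (simp add: in_keys_iff)

lemma finite_le_lookup: "0 < n \<Longrightarrow> finite {i. n \<le> lkp m (i::nat)}" for n :: nat
  by (rule finite_subset[OF _ finite_keys[of m]]) (auto simp: in_keys_iff)

definition mfps_monom :: "monom \<Rightarrow> 'a::zero \<Rightarrow> 'a mfps" where
  "mfps_monom s c = Abs_mfps (\<lambda>m. if m = s then c else 0)"

lemma mcoeff_monom_mult: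
  "mcoeff (mfps_monom s c * g) m = (if \<exists>b. m = s + b then c * mcoeff g (m - s) else 0)"
proof -
  have "mcoeff (mfps_monom s c * g) m = (\<Sum>(a, b)\<in>{(a, b). a + b = m}. (if a = s then c else 0) * mcoeff g b)"
    by (simp add: mcoeff_mult mfps_monom_def)
  also have "\<dots> = (\<Sum>(a, b)\<in>{(a, b). a + b = m \<and> a = s}. c * mcoeff g b)"
    by (rule sum.mono_neutral_cong_right) (auto simp: finite_monom_splittings split: if_splits)
  also have "\<dots> = (if \<exists>b. m = s + b then c * mcoeff g (m - s) else 0)"
  proof (cases "\<exists>b. m = s + b")
    case True
    then have "{(a, b). a + b = m \<and> a = s} = {(s, m - s)}" by auto
    then show ?thesis using True by simp
  next
    case False
    then have E: "{(a, b). a + b = m \<and> a = s} = {}" by auto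
    show ?thesis unfolding E using False by simp
  qed
  finally show ?thesis .
qed

lemma mfps_const_eq_monom: "mfps_const c = mfps_monom 0 c"
  by (simp add: mfps_const_def mfps_monom_def)

lemma mcoeff_const_mult [simp]: "mcoeff (mfps_const c * g) m = c * mcoeff g m"
  by (simp add: mfps_const_eq_monom mcoeff_monom_mult)

text \<open>The monomials y_i^n of the power sum are pairwise distinct because n > 0, and y_i^n
  splits off from m exactly when the exponent of i is at least n. The positivity of n also makes the
  sum over i finite.\<close>

lemma mcoeff_power_sum_mult:
  assumes n: "0 < n"
  shows "mcoeff (power_sum n * g) m =
    (\<Sum>i | n \<le> lkp m i. mcoeff g (m - Poly_Mapping.single i n))"
proof -
  have inj: "Poly_Mapping.single i n = Poly_Mapping.single j n \<longleftrightarrow> i = j" for i j :: nat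
    using n by (metis lookup_single_eq lookup_single_not_eq less_irrefl)
  have "mcoeff (power_sum n * g) m =
    (\<Sum>(a, b)\<in>{(a, b). a + b = m}. (if \<exists>i. a = Poly_Mapping.single i n then 1 else 0) * mcoeff g b)"
    by (simp add: mcoeff_mult power_sum_def)
  also have "\<dots> = (\<Sum>(a, b)\<in>{(a, b). a + b = m \<and> (\<exists>i. a = Poly_Mapping.single i n)}. mcoeff g b)"
    by (rule sum.mono_neutral_cong_right) (auto simp: finite_monom_splittings split: if_splits)
  also have "{(a, b). a + b = m \<and> (\<exists>i. a = Poly_Mapping.single i n)} =
     (\<lambda>i. (Poly_Mapping.single i n, m - Poly_Mapping.single i n)) ` {i. n \<le> lkp m i}"
    by (auto simp: single_add_diff image_iff lookup_add intro!: exI)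
  also have "(\<Sum>(a, b)\<in>\<dots>. mcoeff g b) = (\<Sum>i | n \<le> lkp m i. mcoeff g (m - Poly_Mapping.single i n))"
    by (subst sum.reindex) (auto simp: inj_on_def inj)
  finally show ?thesis .
qed

text \<open>Being multiplicative, this embedding lets polynomial coefficients be computed with the
  convolution of series, and it lets a series be multiplied by a denominator.\<close>

definition of_mpoly :: "'a::zero mpoly \<Rightarrow> 'a mfps" where
  "of_mpoly f = Abs_mfps (lkp f)"

lemma mcoeff_of_mpoly [simp]: "mcoeff (of_mpoly f) = lkp f"
  by (simp add: of_mpoly_def)

lemma of_mpoly_hom:
  "of_mpoly 0 = 0" "of_mpoly 1 = 1" "of_mpoly (f + g) = of_mpoly f + of_mpoly g"
  "of_mpoly (f - g) = of_mpoly f - of_mpoly g" 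
  for f g :: "'a::comm_ring_1 mpoly"
  by (auto intro!: mfps_eqI simp: lookup_add lookup_minus lookup_one when_def)

lemma of_mpoly_single: "of_mpoly (Poly_Mapping.single s c) = mfps_monom s c"
  by (auto intro!: mfps_eqI simp: lookup_single mfps_monom_def when_def)

lemma of_mpoly_mult: "of_mpoly (f * g) = of_mpoly f * of_mpoly g" for f g :: "'a::comm_ring_1 mpoly"
proof (rule mfps_eqI)
  fix m :: monom
  let ?A = "{a. \<exists>b. a + b = m}"
  have fin: "finite ?A"
    by (rule finite_subset[OF _ finite_imageI[OF finite_monom_splittings[of m], of fst]]) force
  \<comment> \<open>Monomials cancel, so at most one c completes l to m, namely
    \<open>m - l\<close>.\<close>
  have inner: "(\<Sum>c. lkp g c when m = l + c) = (if l \<in> ?A then lkp g (m - l) else 0)" for l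
  proof (cases "l \<in> ?A")
    case True
    then have "m = l + c \<longleftrightarrow> c = m - l" for c by auto
    then have "(\<Sum>c. lkp g c when m = l + c) = (\<Sum>c. lkp g c when c = m - l)" by simp
    also have "\<dots> = lkp g (m - l)" by (rule Sum_any_when_equal)
    finally show ?thesis using True by simp
  next
    case False
    then have "m \<noteq> l + c" for c by auto
    then show ?thesis using False by simp
  qed
  have "lkp (f * g) m = (\<Sum>l. lkp f l * (if l \<in> ?A then lkp g (m - l) else 0))"
    by (simp add: lookup_mult inner)
  also have "\<dots> = (\<Sum>l\<in>?A. lkp f l * lkp g (m - l))"
    by (subst Sum_any.expand_superset[OF fin]) (auto intro!: sum.cong split: if_splits)
  also have "\<dots> = (\<Sum>(a, b)\<in>{(a, b). a + b = m}. lkp f a * lkp g b)"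
    by (rule sum.reindex_bij_witness[of _ fst "\<lambda>a. (a, m - a)"]) auto
  finally show "mcoeff (of_mpoly (f * g)) m = mcoeff (of_mpoly f * of_mpoly g) m"
    by (simp add: mcoeff_mult)
qed

lemma of_mpoly_sum: "of_mpoly (sum f A) = (\<Sum>x\<in>A. of_mpoly (f x))" for f :: "_ \<Rightarrow> 'a::comm_ring_1 mpoly"
  by (induction A rule: infinite_finite_induct) (auto simp: of_mpoly_hom)

lemma mpoly_in_hom:
  fixes f g :: "'a::comm_ring_1 mpoly"
  shows "0 \<in> mpoly_in N" "1 \<in> mpoly_in N"
    "f \<in> mpoly_in N \<Longrightarrow> g \<in> mpoly_in N \<Longrightarrow> f + g \<in> mpoly_in N"
    "f \<in> mpoly_in N \<Longrightarrow> g \<in> mpoly_in N \<Longrightarrow> f * g \<in> mpoly_in N"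
proof -
  show "f + g \<in> mpoly_in N" if "f \<in> mpoly_in N" "g \<in> mpoly_in N"
    using that Poly_Mapping.keys_add[of f g] unfolding mpoly_in_def by blast
  show "f * g \<in> mpoly_in N" if fg: "f \<in> mpoly_in N" "g \<in> mpoly_in N"
    unfolding mpoly_in_def
  proof safe
    fix m i assume "m \<in> Poly_Mapping.keys (f * g)" and i: "i \<in> Poly_Mapping.keys m"
    then obtain a b where "m = a + b" "a \<in> Poly_Mapping.keys f" "b \<in> Poly_Mapping.keys g"
      using keys_mult[of f g] by blast
    then show "i < N" using i fg Poly_Mapping.keys_add[of a b] unfolding mpoly_in_def by blast
  qed
qed (auto simp: mpoly_in_def)

section \<open>Power sum expansions\<close>

lemma power_sums_Nil [simp]: "power_sums [] = 1"
  by (simp add: power_sums_def)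

lemma power_sums_Cons: "power_sums (n # \<kappa>) = power_sum n * power_sums \<kappa>"
  by (simp add: power_sums_def)

lemma mcoeff_power_sums_Cons:
  "0 < n \<Longrightarrow> mcoeff (power_sums (n # \<kappa>)) m =
    (\<Sum>i | n \<le> lkp m i. mcoeff (power_sums \<kappa>) (m - Poly_Mapping.single i n))"
  by (simp add: power_sums_Cons mcoeff_power_sum_mult)

lemma power_sums_mset_cong: "mset \<kappa> = mset \<rho> \<Longrightarrow> power_sums \<kappa> = power_sums \<rho>"
  by (metis mset_map power_sums_def prod_mset_prod_list)

lemma power_sums_homogeneous:
  assumes "0 \<notin> set \<kappa>" "mcoeff (power_sums \<kappa>) m \<noteq> 0"
  shows "mdeg m = sum_list \<kappa>"
  using assms
proof (induction \<kappa> arbitrary: m)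
  case (Cons n \<kappa>)
  then have n: "0 < n" by simp
  obtain i where i: "n \<le> lkp m i" "mcoeff (power_sums \<kappa>) (m - Poly_Mapping.single i n) \<noteq> 0"
    using Cons.prems(2) unfolding mcoeff_power_sums_Cons[OF n] by (metis (no_types, lifting) mem_Collect_eq sum.neutral)
  then have "mdeg (m - Poly_Mapping.single i n) = sum_list \<kappa>"
    using Cons by simp
  then have "mdeg m = n + sum_list \<kappa>"
    by (metis i(1) mdeg_add mdeg_single single_add_diff)
  then show ?case by simp
qed (auto split: if_splits)

section \<open>Triangularity of the power sum products in the monomials\<close>

definition mvals :: "monom \<Rightarrow> nat multiset" where
  "mvals m = image_mset (lkp m) (mset_set (Poly_Mapping.keys m))"

lemma size_mvals: "size (mvals m) = card (Poly_Mapping.keys m)"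
  by (simp add: mvals_def)

lemma mvals_eq_empty_iff: "mvals m = {#} \<longleftrightarrow> m = 0"
  by (auto simp: mvals_def mset_set_empty_iff in_keys_iff intro!: poly_mapping_eqI)

lemma mvals_add_single:
  assumes "0 < n" "i \<notin> Poly_Mapping.keys m"
  shows "mvals (Poly_Mapping.single i n + m) = add_mset n (mvals m)"
proof -
  have k: "Poly_Mapping.keys (Poly_Mapping.single i n + m) = insert i (Poly_Mapping.keys m)"
    using assms by (auto simp: in_keys_iff lookup_add lookup_single when_def split: if_splits)
  show ?thesis unfolding mvals_def k using assms
    by (auto simp: lookup_add lookup_single when_def in_keys_iff intro!: image_mset_cong)
qed

text \<open>Expanding a product of power sums involves no cancellation. Carrying the coefficient as
  a natural number keeps this positivity, which over a field of characteristic zero makes the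
  diagonal of the triangular system nonzero.\<close>

lemma power_sums_coeff_nat:
  assumes "0 \<notin> set \<kappa>"
  shows "\<exists>k::nat. mcoeff (power_sums \<kappa>) m = of_nat k \<and> (mvals m = mset \<kappa> \<longrightarrow> 0 < k)"
  using assms
proof (induction \<kappa> arbitrary: m)
  case Nil
  show ?case by (rule exI[of _ "if m = 0 then 1 else 0"]) (auto simp: mvals_eq_empty_iff)
next
  case (Cons n \<kappa>)
  then have n: "0 < n" by simp
  obtain k where k: "\<And>m. mcoeff (power_sums \<kappa>) m = of_nat (k m)" "\<And>m. mvals m = mset \<kappa> \<Longrightarrow> 0 < k m"
    using Cons by (metis list.set_intros(2))
  let ?K = "\<Sum>i | n \<le> lkp m i. k (m - Poly_Mapping.single i n)"
  have "mcoeff (power_sums (n # \<kappa>)) m = of_nat ?K"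
    by (simp add: mcoeff_power_sums_Cons[OF n] k(1))
  \<comment> \<open>Some variable has exponent exactly n. Removing it leaves a monomial of type
    \<kappa>, whose coefficient is positive by induction, and the other summands are natural
    numbers.\<close>
  moreover have "0 < ?K" if mv: "mvals m = mset (n # \<kappa>)"
  proof -
    have "n \<in># mvals m" using mv by simp
    then obtain i where i: "i \<in> Poly_Mapping.keys m" "lkp m i = n"
      by (auto simp: mvals_def)
    define m' where "m' = m - Poly_Mapping.single i n"
    have m: "m = Poly_Mapping.single i n + m'"
      using i single_add_diff[of n m i] unfolding m'_def by simp
    have "i \<notin> Poly_Mapping.keys m'" using i unfolding m'_def by (simp add: in_keys_iff lookup_minus)
    then have "mvals m' = mset \<kappa>"
      using mvals_add_single[OF n] mv unfolding m by auto
    then have "0 < k m'" by (rule k(2))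
    moreover have "k m' \<le> ?K"
      unfolding m'_def using i finite_le_lookup[OF n] by (intro member_le_sum) auto
    ultimately show ?thesis by linarith
  qed
  ultimately show ?case by blast
qed

text \<open>Each factor puts its part on a single variable. So at most as many variables occur as
  there are factors, and if all of these occur then no two parts were merged and the exponents are
  the parts.\<close>

lemma power_sums_triangular:
  assumes "0 \<notin> set \<kappa>" "mcoeff (power_sums \<kappa>) m \<noteq> 0"
  shows "card (Poly_Mapping.keys m) \<le> length \<kappa> \<and>
    (card (Poly_Mapping.keys m) = length \<kappa> \<longrightarrow> mvals m = mset \<kappa>)"
  using assms
proof (induction \<kappa> arbitrary: m)
  case Nil
  then show ?case by (auto simp: mvals_eq_empty_iff split: if_splits)
next
  case (Cons n \<kappa>)
  then have n: "0 < n" by simp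
  obtain i where i: "n \<le> lkp m i" "mcoeff (power_sums \<kappa>) (m - Poly_Mapping.single i n) \<noteq> 0"
    using Cons.prems(2) unfolding mcoeff_power_sums_Cons[OF n] by (metis (no_types, lifting) mem_Collect_eq sum.neutral)
  define m' where "m' = m - Poly_Mapping.single i n"
  have m: "m = Poly_Mapping.single i n + m'"
    using i single_add_diff[of n m i] unfolding m'_def by simp
  have IH: "card (Poly_Mapping.keys m') \<le> length \<kappa>" "card (Poly_Mapping.keys m') = length \<kappa> \<Longrightarrow> mvals m' = mset \<kappa>"
    using Cons.IH[of m'] Cons.prems i unfolding m'_def by auto
  show ?case
  proof (cases "i \<in> Poly_Mapping.keys m'")
    case True
    then have "Poly_Mapping.keys m \<subseteq> Poly_Mapping.keys m'"
      unfolding m by (auto simp: in_keys_iff lookup_add lookup_single when_def split: if_splits)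
    then have "card (Poly_Mapping.keys m) \<le> card (Poly_Mapping.keys m')" by (simp add: card_mono)
    then show ?thesis using IH by simp
  next
    case False
    then have "mvals m = add_mset n (mvals m')" using mvals_add_single[OF n] m by blast
    then show ?thesis using IH by (simp flip: size_mvals)
  qed
qed

lemma lookup_map_key: "inj \<pi> \<Longrightarrow> lkp (Poly_Mapping.map_key \<pi> m) i = lkp m (\<pi> i)"
  by (simp add: map_key.rep_eq)

lemma mdeg_map_key:
  assumes "bij \<pi>"
  shows "mdeg (Poly_Mapping.map_key \<pi> m) = mdeg m"
proof -
  have inj: "inj \<pi>" using assms by (rule bij_is_inj)
  have "bij_betw \<pi> (\<pi> -` Poly_Mapping.keys m) (Poly_Mapping.keys m)"
    using assms by (auto simp: bij_betw_def inj_on_def bij_def surj_image_vimage_eq)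
  then show ?thesis
    using sum.reindex_bij_betw[of \<pi> "\<pi> -` Poly_Mapping.keys m" "Poly_Mapping.keys m" "lkp m"]
    by (simp add: mdeg_def keys_map_key inj lookup_map_key)
qed

lemma power_sums_sym:
  assumes "0 \<notin> set \<kappa>"
  shows "power_sums \<kappa> \<in> Sym_hat"
proof -
  have "mcoeff (power_sums \<kappa>) (Poly_Mapping.map_key \<pi> m) = mcoeff (power_sums \<kappa>) m" if "bij \<pi>" for \<pi> m
    using assms
  proof (induction \<kappa> arbitrary: m)
    case Nil
    have "Poly_Mapping.map_key \<pi> m = 0 \<longleftrightarrow> m = 0"
      using mdeg_map_key[OF that, of m] by (metis mdeg_eq_0_iff)
    then show ?case by simp
  next
    case (Cons n \<kappa>)
    then have n: "0 < n" by simp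
    have inj: "inj \<pi>" using that by (rule bij_is_inj)
    have eq: "Poly_Mapping.map_key \<pi> m - Poly_Mapping.single i n = Poly_Mapping.map_key \<pi> (m - Poly_Mapping.single (\<pi> i) n)" for i
      using inj by (intro poly_mapping_eqI) (auto simp: lookup_minus lookup_map_key lookup_single when_def inj_eq)
    have bb: "bij_betw \<pi> {i. n \<le> lkp m (\<pi> i)} {i. n \<le> lkp m i}"
      using that by (auto simp: bij_betw_def inj_on_def bij_def image_iff)
    have "mcoeff (power_sums (n # \<kappa>)) (Poly_Mapping.map_key \<pi> m)
      = (\<Sum>i | n \<le> lkp m (\<pi> i). mcoeff (power_sums \<kappa>) (m - Poly_Mapping.single (\<pi> i) n))"
      using Cons by (simp add: mcoeff_power_sums_Cons[OF n] lookup_map_key[OF inj] eq)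
    also have "\<dots> = mcoeff (power_sums (n # \<kappa>)) m"
      unfolding mcoeff_power_sums_Cons[OF n] by (rule sum.reindex_bij_betw[OF bb])
    finally show ?case .
  qed
  then show ?thesis by (simp add: Sym_hat_def)
qed

lemma partition_mset_inj:
  assumes "is_partition \<kappa>" "is_partition \<rho>" "mset \<kappa> = mset \<rho>"
  shows "\<kappa> = \<rho>"
proof -
  have "sorted (rev \<kappa>)" "sorted (rev \<rho>)"
    using assms by (auto simp: is_partition_def sorted_wrt_rev)
  then have "rev \<kappa> = rev \<rho>" using assms(3) by (metis mset_rev properties_for_sort)
  then show ?thesis by simp
qed

lemma length_le_sum_list: "0 \<notin> set \<kappa> \<Longrightarrow> length \<kappa> \<le> sum_list \<kappa>" for \<kappa> :: "nat list"
  by (induction \<kappa>) auto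

lemma finite_partitions_le: "finite {\<kappa>. is_partition \<kappa> \<and> sum_list \<kappa> \<le> d}"
proof (rule finite_subset)
  show "{\<kappa>. is_partition \<kappa> \<and> sum_list \<kappa> \<le> d} \<subseteq> {\<kappa>. set \<kappa> \<subseteq> {..d} \<and> length \<kappa> \<le> d}"
  proof safe
    fix \<kappa> x assume \<kappa>: "is_partition \<kappa>" "sum_list \<kappa> \<le> d"
    show "x \<le> d" if "x \<in> set \<kappa>"
      using member_le_sum_list[OF that] \<kappa> by simp
    show "length \<kappa> \<le> d"
      using length_le_sum_list[of \<kappa>] \<kappa> by (simp add: is_partition_def)
  qed
qed (simp add: finite_lists_length_le)

lemma finite_partitions: "finite {\<kappa>. is_partition \<kappa> \<and> sum_list \<kappa> = d}"
  by (rule finite_subset[OF _ finite_partitions_le[of d]]) auto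

definition mon :: "nat list \<Rightarrow> monom" where
  "mon \<mu> = Abs_poly_mapping (part \<mu>)"

lemma lookup_mon [simp]: "lkp (mon \<mu>) = part \<mu>"
proof -
  have "finite {x. part \<mu> x \<noteq> 0}"
    by (rule finite_subset[of _ "{..<length \<mu>}"]) (auto simp: part_def split: if_splits)
  then show ?thesis by (simp add: mon_def)
qed

lemma keys_mon: "0 \<notin> set \<mu> \<Longrightarrow> Poly_Mapping.keys (mon \<mu>) = {..<length \<mu>}"
  by (auto simp: in_keys_iff part_def split: if_splits) (metis gr0I nth_mem)

lemma mvals_mon:
  assumes "0 \<notin> set \<mu>"
  shows "mvals (mon \<mu>) = mset \<mu>"
proof -
  have "mvals (mon \<mu>) = image_mset (\<lambda>i. \<mu> ! i) (mset_set {0..<length \<mu>})"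
    unfolding mvals_def keys_mon[OF assms] atLeast0LessThan by (rule image_mset_cong) (auto simp: part_def)
  also have "\<dots> = mset (map ((!) \<mu>) [0..<length \<mu>])" by (simp only: mset_map mset_upt)
  also have "\<dots> = mset \<mu>" by (simp add: map_nth)
  finally show ?thesis .
qed

lemma mdeg_mon: "mdeg (mon \<mu>) = sum_list \<mu>"
proof -
  have "Poly_Mapping.keys (mon \<mu>) \<subseteq> {..<length \<mu>}"
    by (auto simp: in_keys_iff part_def split: if_splits)
  then have "mdeg (mon \<mu>) = (\<Sum>i<length \<mu>. part \<mu> i)"
    by (subst mdeg_eq_sum[of "{..<length \<mu>}"]) auto
  also have "\<dots> = (\<Sum>i<length \<mu>. \<mu> ! i)" by (rule sum.cong) (auto simp: part_def)
  finally show ?thesis by (simp add: sum_list_sum_nth atLeast0LessThan)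
qed

text \<open>Every orbit of monomials under permutations of the variables contains a partition-shaped
  one, so a symmetric series is determined by its coefficients at the monomials
  \<open>mon \<mu>\<close>.\<close>

lemma monom_sort:
  fixes m :: monom
  obtains \<mu> \<pi> where "is_partition \<mu>" "bij \<pi>" "Poly_Mapping.map_key \<pi> m = mon \<mu>"
proof -
  \<comment> \<open>R bounds the support: a permutation of the first R variables suffices, the rest
    staying fixed.\<close>
  define R where "R = Suc (Max (insert 0 (Poly_Mapping.keys m)))"
  have R: "lkp m i = 0" if "i \<ge> R" for i
  proof (rule ccontr)
    assume "lkp m i \<noteq> 0"
    then have "i \<le> Max (insert 0 (Poly_Mapping.keys m))" by (intro Max_ge) (auto simp: in_keys_iff)
    then show False using that by (simp add: R_def)
  qed
  define xs where "xs = map (lkp m) [0..<R]"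
  define \<mu> where "\<mu> = rev (sort (filter (\<lambda>x. x \<noteq> 0) xs))"
  \<comment> \<open>The zero exponents go behind the parts, so that both lists have length R and
    differ by a permutation.\<close>
  define ys where "ys = \<mu> @ filter (\<lambda>x. x = 0) xs"
  have "mset ys = mset xs"
    unfolding ys_def \<mu>_def by (simp add: union_filter_mset_complement)
  then obtain \<pi> where \<pi>: "\<pi> permutes {..<R}" "permute_list \<pi> xs = ys"
    by (rule mset_eq_permutation) (auto simp: xs_def)
  have part: "is_partition \<mu>"
    unfolding is_partition_def \<mu>_def by (auto simp: sorted_wrt_rev)
  have len: "length ys = R" using \<pi>(2) by (metis length_permute_list length_map xs_def length_upt diff_zero)
  have ys: "ys ! i = part \<mu> i" if "i < R" for i
  proof (cases "i < length \<mu>")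
    case False
    then have "ys ! i \<in> set (filter (\<lambda>x. x = 0) xs)"
      using that len by (auto simp: ys_def nth_append intro!: nth_mem simp del: set_filter)
    then show ?thesis using False by (simp add: part_def)
  qed (simp add: ys_def nth_append part_def)
  have "Poly_Mapping.map_key \<pi> m = mon \<mu>"
  proof (rule poly_mapping_eqI)
    fix i
    have inj: "inj \<pi>" using \<pi>(1) by (rule permutes_inj)
    show "lkp (Poly_Mapping.map_key \<pi> m) i = lkp (mon \<mu>) i"
    proof (cases "i < R")
      case True
      then have "\<pi> i < R" using \<pi>(1) by (metis lessThan_iff permutes_in_image)
      then have "lkp m (\<pi> i) = xs ! \<pi> i" by (simp add: xs_def)
      also have "\<dots> = ys ! i"
        using \<pi> True by (metis permute_list_nth length_map length_upt diff_zero xs_def)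
      finally show ?thesis using ys True by (simp add: lookup_map_key[OF inj])
    next
      case False
      then have "\<pi> i = i" using \<pi>(1) by (auto simp: permutes_def)
      moreover have "length \<mu> \<le> R" using len by (simp add: ys_def)
      ultimately show ?thesis using False R by (simp add: lookup_map_key[OF inj] part_def)
    qed
  qed
  with part permutes_bij[OF \<pi>(1)] show ?thesis using that by blast
qed

lemma power_sums_mon_triangular:
  assumes "is_partition \<kappa>" "is_partition \<rho>" "mcoeff (power_sums \<rho>) (mon \<kappa>) \<noteq> 0"
  shows "\<rho> = \<kappa> \<or> length \<kappa> < length \<rho>"
  using power_sums_triangular[of \<rho> "mon \<kappa>"] partition_mset_inj[of \<kappa> \<rho>] assms
  by (auto simp: is_partition_def keys_mon mvals_mon)

lemma power_sums_mon_diag: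
  assumes "is_partition \<kappa>"
  shows "mcoeff (power_sums \<kappa>) (mon \<kappa>) \<noteq> 0"
  using power_sums_coeff_nat[of \<kappa> "mon \<kappa>"] assms by (auto simp: is_partition_def mvals_mon)

section \<open>Existence and uniqueness of power sum expansions\<close>

definition p_expansion :: "qt mfps \<Rightarrow> (nat list \<Rightarrow> qt) \<Rightarrow> bool" where
  "p_expansion f c \<longleftrightarrow> (\<forall>\<kappa>. \<not> is_partition \<kappa> \<longrightarrow> c \<kappa> = 0) \<and>
     (\<forall>m. mcoeff f m =
        (\<Sum>\<kappa> | is_partition \<kappa> \<and> sum_list \<kappa> = mdeg m. c \<kappa> * mcoeff (power_sums \<kappa>) m))"

lemma p_expansion_non_partition: "p_expansion f c \<Longrightarrow> \<not> is_partition \<kappa> \<Longrightarrow> c \<kappa> = 0"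
  by (simp add: p_expansion_def)

lemma p_expansionD:
  "p_expansion f c \<Longrightarrow> mcoeff f m =
    (\<Sum>\<kappa> | is_partition \<kappa> \<and> sum_list \<kappa> = mdeg m. c \<kappa> * mcoeff (power_sums \<kappa>) m)"
  by (simp add: p_expansion_def)

text \<open>At \<open>mon \<kappa>\<close> only \<kappa> itself and longer partitions of the same
  size contribute. The coefficients of the longer ones agree by induction, and the diagonal entry is
  nonzero. The measure is well chosen because the length never exceeds the size.\<close>

lemma p_expansion_unique:
  assumes "p_expansion f c" "p_expansion f c'"
  shows "c = c'"
proof
  fix \<kappa>
  show "c \<kappa> = c' \<kappa>"
  proof (induction "sum_list \<kappa> - length \<kappa>" arbitrary: \<kappa> rule: less_induct)
    case less
    show ?case
    proof (cases "is_partition \<kappa>")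
      case True
      let ?S = "{\<rho>. is_partition \<rho> \<and> sum_list \<rho> = sum_list \<kappa>}"
      have "(\<Sum>\<rho>\<in>?S. c \<rho> * mcoeff (power_sums \<rho>) (mon \<kappa>)) = (\<Sum>\<rho>\<in>?S. c' \<rho> * mcoeff (power_sums \<rho>) (mon \<kappa>))"
        using p_expansionD[OF assms(1), of "mon \<kappa>"] p_expansionD[OF assms(2), of "mon \<kappa>"]
        unfolding mdeg_mon by (rule trans[OF sym])
      moreover have "c \<rho> * mcoeff (power_sums \<rho>) (mon \<kappa>) = c' \<rho> * mcoeff (power_sums \<rho>) (mon \<kappa>)"
        if "\<rho> \<in> ?S - {\<kappa>}" for \<rho>
      proof (cases "mcoeff (power_sums \<rho>) (mon \<kappa>) = 0")
        case False
        then have "length \<kappa> < length \<rho>"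
          using power_sums_mon_triangular[of \<kappa> \<rho>] True that by auto
        moreover have "length \<rho> \<le> sum_list \<rho>"
          using that by (intro length_le_sum_list) (auto simp: is_partition_def)
        ultimately have "c \<rho> = c' \<rho>" using that by (intro less) auto
        then show ?thesis by simp
      qed simp
      then have "(\<Sum>\<rho>\<in>?S - {\<kappa>}. c \<rho> * mcoeff (power_sums \<rho>) (mon \<kappa>)) = (\<Sum>\<rho>\<in>?S - {\<kappa>}. c' \<rho> * mcoeff (power_sums \<rho>) (mon \<kappa>))"
        by (rule sum.cong[OF refl])
      ultimately have "c \<kappa> * mcoeff (power_sums \<kappa>) (mon \<kappa>) = c' \<kappa> * mcoeff (power_sums \<kappa>) (mon \<kappa>)"
        using True by (simp add: sum.remove[OF finite_partitions[of "sum_list \<kappa>"], of \<kappa>])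
      then show ?thesis using power_sums_mon_diag[OF True] by simp
    next
      case False
      then show ?thesis using assms by (simp add: p_expansion_def)
    qed
  qed
qed

text \<open>Back substitution in the triangular system, starting with the longest partitions of each
  size.\<close>

function triangular_coeff :: "qt mfps \<Rightarrow> nat list \<Rightarrow> qt" where
  "triangular_coeff f \<kappa> = (if is_partition \<kappa> then
     (mcoeff f (mon \<kappa>) - (\<Sum>\<rho> | is_partition \<rho> \<and> sum_list \<rho> = sum_list \<kappa> \<and> length \<kappa> < length \<rho>.
        triangular_coeff f \<rho> * mcoeff (power_sums \<rho>) (mon \<kappa>))) / mcoeff (power_sums \<kappa>) (mon \<kappa>) else 0)"
  by auto
termination
proof (relation "measure (\<lambda>(f, \<kappa>). sum_list \<kappa> - length \<kappa>)", goal_cases)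
  case (2 f \<kappa> \<rho>)
  then show ?case using length_le_sum_list[of \<rho>] by (auto simp: is_partition_def)
qed simp

declare triangular_coeff.simps [simp del]

text \<open>Both sides are symmetric, so the expansion has to be checked only at the monomials
  \<open>mon \<kappa>\<close>, where it is the defining recursion solved for the coefficient of the
  series.\<close>

lemma p_expansion_triangular_coeff:
  assumes f: "f \<in> Sym_hat"
  shows "p_expansion f (triangular_coeff f)"
  unfolding p_expansion_def
proof (intro conjI allI impI)
  fix m :: monom
  let ?c = "triangular_coeff f"
  obtain \<kappa> \<pi> where \<kappa>: "is_partition \<kappa>" "bij \<pi>" "Poly_Mapping.map_key \<pi> m = mon \<kappa>"
    using monom_sort[of m] by blast
  have sym: "mcoeff g m = mcoeff g (mon \<kappa>)" if "g \<in> Sym_hat" for g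
  proof -
    have "mcoeff g (Poly_Mapping.map_key \<pi> m) = mcoeff g m"
      using that \<kappa>(2) unfolding Sym_hat_def by blast
    then show ?thesis using \<kappa>(3) by simp
  qed
  have deg: "mdeg m = sum_list \<kappa>"
    using \<kappa> mdeg_map_key mdeg_mon by metis
  let ?S = "{\<rho>. is_partition \<rho> \<and> sum_list \<rho> = sum_list \<kappa>}"
  let ?T = "{\<rho>. is_partition \<rho> \<and> sum_list \<rho> = sum_list \<kappa> \<and> length \<kappa> < length \<rho>}"
  have fin: "finite ?T" by (rule finite_subset[OF _ finite_partitions[of "sum_list \<kappa>"]]) auto
  have "mcoeff f (mon \<kappa>) = ?c \<kappa> * mcoeff (power_sums \<kappa>) (mon \<kappa>) + (\<Sum>\<rho>\<in>?T. ?c \<rho> * mcoeff (power_sums \<rho>) (mon \<kappa>))"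
    using power_sums_mon_diag[OF \<kappa>(1)] \<kappa>(1) by (subst triangular_coeff.simps) simp
  also have "\<dots> = (\<Sum>\<rho>\<in>insert \<kappa> ?T. ?c \<rho> * mcoeff (power_sums \<rho>) (mon \<kappa>))"
    using fin by simp
  also have "\<dots> = (\<Sum>\<rho>\<in>?S. ?c \<rho> * mcoeff (power_sums \<rho>) (mon \<kappa>))"
    using power_sums_mon_triangular[OF \<kappa>(1)] \<kappa>(1)
    by (intro sum.mono_neutral_left finite_partitions) auto
  also have "\<dots> = (\<Sum>\<rho>\<in>?S. ?c \<rho> * mcoeff (power_sums \<rho>) m)"
    by (intro sum.cong refl) (auto simp: is_partition_def sym power_sums_sym)
  finally show "mcoeff f m = (\<Sum>\<rho> | is_partition \<rho> \<and> sum_list \<rho> = mdeg m. ?c \<rho> * mcoeff (power_sums \<rho>) m)"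
    unfolding deg using sym[OF f] by simp
qed (simp add: triangular_coeff.simps)

lemma p_coeffs_eqI:
  assumes "p_expansion f c"
  shows "p_coeffs f = c"
  unfolding p_coeffs_def using assms p_expansion_unique
  by (intro the_equality) (auto simp flip: p_expansion_def)

lemma p_expansion_p_coeffs: "f \<in> Sym_hat \<Longrightarrow> p_expansion f (p_coeffs f)"
  using p_coeffs_eqI p_expansion_triangular_coeff by metis

lemma p_coeffs_non_partition: "f \<in> Sym_hat \<Longrightarrow> \<not> is_partition \<kappa> \<Longrightarrow> p_coeffs f \<kappa> = 0"
  using p_expansion_non_partition[OF p_expansion_p_coeffs] by blast

text \<open>If the homogeneous component of degree |\<kappa>| is zero, deleting all coefficients of
  that size gives another expansion of the same series, and expansions are unique.\<close>

lemma p_coeffs_eq_0: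
  assumes f: "f \<in> Sym_hat" and van: "\<And>m. mdeg m = sum_list \<kappa> \<Longrightarrow> mcoeff f m = 0"
  shows "p_coeffs f \<kappa> = 0"
proof -
  have ex: "p_expansion f (p_coeffs f)" using f by (rule p_expansion_p_coeffs)
  let ?c = "\<lambda>\<rho>. if sum_list \<rho> = sum_list \<kappa> then 0 else p_coeffs f \<rho>"
  have "p_expansion f ?c"
    unfolding p_expansion_def
  proof (intro conjI allI impI)
    fix m :: monom
    show "mcoeff f m = (\<Sum>\<rho> | is_partition \<rho> \<and> sum_list \<rho> = mdeg m. ?c \<rho> * mcoeff (power_sums \<rho>) m)"
    proof (cases "mdeg m = sum_list \<kappa>")
      case True
      moreover have "(\<Sum>\<rho> | is_partition \<rho> \<and> sum_list \<rho> = mdeg m. ?c \<rho> * mcoeff (power_sums \<rho>) m) = 0"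
        by (rule sum.neutral) (use True in simp)
      ultimately show ?thesis using van by simp
    next
      case False
      show ?thesis unfolding p_expansionD[OF ex, of m] by (rule sum.cong) (use False in simp_all)
    qed
  qed (simp add: p_expansion_non_partition[OF ex])
  then have "p_coeffs f = ?c" by (rule p_coeffs_eqI)
  then show ?thesis by (metis (no_types, lifting))
qed

lemma finite_p_coeffs:
  assumes "f \<in> Sym"
  shows "finite {\<kappa>. p_coeffs f \<kappa> \<noteq> 0}"
proof -
  obtain d where d: "\<And>m. mcoeff f m \<noteq> 0 \<Longrightarrow> mdeg m \<le> d" and f: "f \<in> Sym_hat"
    using assms by (auto simp: Sym_def)
  have "{\<kappa>. p_coeffs f \<kappa> \<noteq> 0} \<subseteq> {\<kappa>. is_partition \<kappa> \<and> sum_list \<kappa> \<le> d}"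
    using p_coeffs_non_partition[OF f] p_coeffs_eq_0[OF f] d by (metis (mono_tags, lifting) mem_Collect_eq subsetI)
  then show ?thesis using finite_partitions_le finite_subset by blast
qed

section \<open>Evaluation at the interpolation points\<close>

definition monom_eval :: "(nat \<Rightarrow> 'a::comm_semiring_1) \<Rightarrow> monom \<Rightarrow> 'a" where
  "monom_eval x m = (\<Prod>i\<in>Poly_Mapping.keys m. x i ^ lkp m i)"

lemma monom_eval_superset:
  "finite A \<Longrightarrow> Poly_Mapping.keys m \<subseteq> A \<Longrightarrow> monom_eval x m = (\<Prod>i\<in>A. x i ^ lkp m i)"
  unfolding monom_eval_def by (rule prod.mono_neutral_left) (auto simp: in_keys_iff)

lemma monom_eval_add: "monom_eval x (a + b) = monom_eval x a * monom_eval x b"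
proof -
  let ?A = "Poly_Mapping.keys a \<union> Poly_Mapping.keys b"
  have "monom_eval x (a + b) = (\<Prod>i\<in>?A. x i ^ lkp (a + b) i)"
    by (rule monom_eval_superset) (use Poly_Mapping.keys_add[of a b] in auto)
  also have "\<dots> = monom_eval x a * monom_eval x b"
    by (subst (1 2) monom_eval_superset[of ?A]) (auto simp: lookup_add power_add prod.distrib)
  finally show ?thesis .
qed

lemma mpoly_eval_superset:
  "finite A \<Longrightarrow> Poly_Mapping.keys f \<subseteq> A \<Longrightarrow> mpoly_eval x f = (\<Sum>m\<in>A. lkp f m * monom_eval x m)"
  unfolding mpoly_eval_def monom_eval_def
  by (rule sum.mono_neutral_left) (auto simp: in_keys_iff)

lemma mpoly_eval_add: "mpoly_eval x (f + g) = mpoly_eval x f + mpoly_eval x g"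
proof -
  let ?A = "Poly_Mapping.keys f \<union> Poly_Mapping.keys g"
  have "mpoly_eval x (f + g) = (\<Sum>m\<in>?A. lkp (f + g) m * monom_eval x m)"
    by (rule mpoly_eval_superset) (use Poly_Mapping.keys_add[of f g] in auto)
  also have "\<dots> = mpoly_eval x f + mpoly_eval x g"
    by (subst (1 2) mpoly_eval_superset[of ?A]) (auto simp: lookup_add distrib_right sum.distrib)
  finally show ?thesis .
qed

lemma mpoly_eval_single: "mpoly_eval x (Poly_Mapping.single s c) = c * monom_eval x s"
  by (subst mpoly_eval_superset[of "{s}"]) auto

lemma mpoly_eval_0: "mpoly_eval x 0 = 0"
  by (simp add: mpoly_eval_def)

lemma mpoly_eval_1: "mpoly_eval x 1 = 1"
  using mpoly_eval_single[of x 0 1] by (simp add: monom_eval_def)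

lemma mpoly_eval_sum: "mpoly_eval x (sum f A) = (\<Sum>a\<in>A. mpoly_eval x (f a))"
  by (induction A rule: infinite_finite_induct) (auto simp: mpoly_eval_0 mpoly_eval_add)

lemma mpoly_sum_singles: "f = (\<Sum>m\<in>Poly_Mapping.keys f. Poly_Mapping.single m (lkp f m))"
proof (rule poly_mapping_eqI)
  fix k
  show "lkp f k = lkp (\<Sum>m\<in>Poly_Mapping.keys f. Poly_Mapping.single m (lkp f m)) k"
    by (cases "k \<in> Poly_Mapping.keys f") (auto simp: lookup_sum lookup_single when_def in_keys_iff)
qed

lemma mpoly_eval_mult: "mpoly_eval x (f * g) = mpoly_eval x f * mpoly_eval x g" for f :: "'a::comm_semiring_1 mpoly"
proof -
  have "f * g = (\<Sum>m\<in>Poly_Mapping.keys f. \<Sum>n\<in>Poly_Mapping.keys g. Poly_Mapping.single (m + n) (lkp f m * lkp g n))"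
    by (subst mpoly_sum_singles[of f], subst mpoly_sum_singles[of g]) (simp add: sum_product mult_single)
  then show ?thesis
    by (simp add: mpoly_eval_sum mpoly_eval_single monom_eval_add mpoly_eval_superset[of "Poly_Mapping.keys f" f]
        mpoly_eval_superset[of "Poly_Mapping.keys g" g] sum_product mult_ac)
qed

lemma mpoly_eval_prod_list: "mpoly_eval x (prod_list fs) = prod_list (map (mpoly_eval x) fs)"
  by (induction fs) (auto simp: mpoly_eval_1 mpoly_eval_mult)

section \<open>Independence of q and t\<close>

lemma t_power_neq_1: "0 < n \<Longrightarrow> t ^ n \<noteq> 1"
proof
  assume n: "0 < n" and "t ^ n = 1"
  have "t ^ n = Fract ([:0, 1:] ^ n) 1" for n
    by (induction n) (auto simp: t_def One_fract_def)
  then have "[:0, 1::rat poly:] ^ n = 1"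
    using \<open>t ^ n = 1\<close> by (simp add: One_fract_def eq_fract)
  then have "degree ([:0, 1::rat poly:] ^ n) = 0" by simp
  then show False using n by (simp add: degree_power_eq)
qed

lemma q_power_Fract: "q ^ n = Fract [:monom 1 n:] 1"
  by (induction n) (auto simp: q_def One_fract_def monom_Suc pCons_one)

lemma q_power_neq_1: "0 < n \<Longrightarrow> q ^ n \<noteq> 1"
proof
  assume n: "0 < n" and "q ^ n = 1"
  then have "[:monom (1::rat) n:] = 1"
    unfolding q_power_Fract by (simp add: One_fract_def eq_fract)
  then have "monom (1::rat) n = 1" by (simp add: one_pCons)
  then show False using n by (metis degree_1 degree_monom_eq one_neq_zero less_irrefl)
qed

lemma q_neq_0: "q \<noteq> 0"
  by (simp add: q_def Zero_fract_def eq_fract)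

lemma Fract_sum: "Fract (sum f A) 1 = (\<Sum>a\<in>A. Fract (f a) (1::'a::idom))"
proof -
  have "Fract (a + b) 1 = Fract a 1 + Fract b (1::'a)" for a b by simp
  then show ?thesis
    by (induction A rule: infinite_finite_induct) (simp_all add: Zero_fract_def del: add_fract)
qed

text \<open>After multiplication by a power of q the relation lies in the polynomial ring in t over
  the polynomials in q, where coefficients of t^i can be compared.\<close>

lemma qt_separation:
  fixes a b :: "nat \<Rightarrow> nat"
  assumes "(\<Sum>i<N. (inverse q ^ a i - inverse q ^ b i) * t ^ i) = 0" "i < N"
  shows "a i = b i"
proof -
  \<comment> \<open>Any common bound for the exponents would do; it clears the negative powers of
    q.\<close>
  define M where "M = (\<Sum>i<N. a i + b i)"
  have M: "a i \<le> M" "b i \<le> M" if "i < N" for i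
    using that member_le_sum[of i "{..<N}" "\<lambda>i. a i + b i"] unfolding M_def by auto
  have pw: "q ^ M * inverse q ^ k = q ^ (M - k)" if "k \<le> M" for k
    using that q_neq_0 by (simp add: power_diff power_inverse field_simps)
  let ?p = "\<Sum>i<N. monom (monom (1::rat) (M - a i) - monom 1 (M - b i)) i"
  have tp: "Fract (monom c i) 1 = Fract [:c:] 1 * t ^ i" for c :: "rat poly" and i
  proof (induction i)
    case (Suc i)
    have "Fract (monom c (Suc i)) 1 = Fract (monom c i * [:0, 1:]) (1 * 1)" by (simp add: monom_Suc)
    also have "\<dots> = Fract (monom c i) 1 * t" by (simp only: t_def mult_fract)
    finally show ?case using Suc by (simp add: mult_ac)
  qed (simp add: monom_0)
  have "Fract ?p 1 = (\<Sum>i<N. Fract (monom (monom (1::rat) (M - a i) - monom 1 (M - b i)) i) 1)"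
    by (rule Fract_sum)
  also have "\<dots> = (\<Sum>i<N. (q ^ (M - a i) - q ^ (M - b i)) * t ^ i)"
    unfolding tp q_power_Fract by simp
  also have "\<dots> = (\<Sum>i<N. q ^ M * ((inverse q ^ a i - inverse q ^ b i) * t ^ i))"
    by (rule sum.cong) (auto simp: pw[symmetric] M algebra_simps)
  also have "\<dots> = 0" using assms(1) by (simp flip: sum_distrib_left)
  finally have "?p = 0" by (simp add: Zero_fract_def eq_fract)
  then have "coeff ?p i = 0" by simp
  then have "monom (1::rat) (M - a i) = monom 1 (M - b i)"
    using \<open>i < N\<close> by (simp add: coeff_sum)
  then have "M - a i = M - b i"
    by (metis degree_monom_eq one_neq_zero)
  then show ?thesis using M[OF \<open>i < N\<close>] by simp
qed

text \<open>The value of \<open>p\<^sub>n\<close> at the infinite point \<open>(q^(-\<eta>\<^sub>1), q^(-\<eta>\<^sub>2) t, \<dots>)\<close>.\<close>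

definition spec :: "nat list \<Rightarrow> nat \<Rightarrow> qt" where
  "spec \<eta> n = (\<Sum>i<length \<eta>. X_point \<eta> i ^ n - t ^ (i * n)) + 1 / (1 - t ^ n)"

definition spec_list :: "nat list \<Rightarrow> nat list \<Rightarrow> qt" where
  "spec_list \<eta> \<kappa> = prod_list (map (spec \<eta>) \<kappa>)"

text \<open>The constant in phi_N is the tail of the geometric series of the t^(i n) with i \<ge> N.
  A row beyond the length of \<eta> also contributes t^(i n), so the value does not depend on N: the
  points in all numbers of variables give one morphism on symmetric functions.\<close>

lemma eval_phi_power_sum:
  assumes n: "0 < n" and N: "length \<eta> \<le> N"
  shows "mpoly_eval (X_point \<eta>) (phi_power_sum N n) = spec \<eta> n"
proof -
  have "mpoly_eval (X_point \<eta>) (phi_power_sum N n) = (\<Sum>i<N. X_point \<eta> i ^ n) + t ^ (N * n) / (1 - t ^ n)"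
    using n by (simp add: phi_power_sum_def mpoly_eval_add mpoly_eval_sum mpoly_eval_single mpoly_const_def monom_eval_def)
  also have "(\<Sum>i<N. X_point \<eta> i ^ n) = (\<Sum>i<N. X_point \<eta> i ^ n - t ^ (i * n)) + (\<Sum>i<N. (t ^ n) ^ i)"
    by (simp add: sum_subtractf power_mult[symmetric] mult.commute)
  also have "(\<Sum>i<N. X_point \<eta> i ^ n - t ^ (i * n)) = (\<Sum>i<length \<eta>. X_point \<eta> i ^ n - t ^ (i * n))"
    using N by (intro sum.mono_neutral_right) (auto simp: X_point_def part_def power_mult)
  also have "(\<Sum>i<N. (t ^ n) ^ i) = (1 - t ^ (N * n)) / (1 - t ^ n)"
  proof -
    have "t ^ (N * n) = (t ^ n) ^ N" by (simp add: power_mult[symmetric] mult.commute)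
    then show ?thesis using t_power_neq_1[OF n] by (simp only: sum_gp_strict if_False)
  qed
  finally show ?thesis by (simp add: spec_def diff_divide_distrib)
qed

lemma eval_phi:
  assumes N: "length \<eta> \<le> N" and f: "f \<in> Sym_hat"
  shows "mpoly_eval (X_point \<eta>) (phi N f) = (\<Sum>\<kappa> | p_coeffs f \<kappa> \<noteq> 0. p_coeffs f \<kappa> * spec_list \<eta> \<kappa>)"
proof -
  have "mpoly_eval (X_point \<eta>) (prod_list (map (phi_power_sum N) \<kappa>)) = spec_list \<eta> \<kappa>"
    if "0 \<notin> set \<kappa>" for \<kappa>
    using that N unfolding spec_list_def mpoly_eval_prod_list map_map
    by (intro arg_cong[of _ _ prod_list] map_cong refl) (auto intro!: eval_phi_power_sum intro: gr0I)
  moreover have "0 \<notin> set \<kappa>" if "p_coeffs f \<kappa> \<noteq> 0" for \<kappa>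
    using p_coeffs_non_partition[OF f] that by (auto simp: is_partition_def)
  ultimately show ?thesis
    unfolding phi_def mpoly_eval_sum
    by (intro sum.cong refl) (auto simp: mpoly_eval_mult mpoly_const_def mpoly_eval_single monom_eval_def)
qed

text \<open>Padding both partitions with zeros to a common length turns equality of the values into
  a vanishing combination of the powers t^i.\<close>

lemma spec_1_inj:
  assumes "is_partition \<eta>" "is_partition \<nu>" "spec \<eta> 1 = spec \<nu> 1"
  shows "\<eta> = \<nu>"
proof -
  define N where "N = max (length \<eta>) (length \<nu>)"
  have spec: "spec \<kappa> 1 = (\<Sum>i<N. X_point \<kappa> i - t ^ i) + 1 / (1 - t)" if "length \<kappa> \<le> N" for \<kappa>
  proof -
    have "(\<Sum>i<length \<kappa>. X_point \<kappa> i - t ^ i) = (\<Sum>i<N. X_point \<kappa> i - t ^ i)"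
      by (rule sum.mono_neutral_left) (use that in \<open>auto simp: X_point_def part_def\<close>)
    then show ?thesis by (simp add: spec_def)
  qed
  have "(\<Sum>i<N. X_point \<eta> i - t ^ i) - (\<Sum>i<N. X_point \<nu> i - t ^ i) = 0"
    using assms(3) spec[of \<eta>] spec[of \<nu>] by (simp add: N_def)
  then have "(\<Sum>i<N. (inverse q ^ part \<eta> i - inverse q ^ part \<nu> i) * t ^ i) = 0"
    by (simp add: X_point_def left_diff_distrib flip: sum_subtractf)
  then have eq: "part \<eta> i = part \<nu> i" if "i < N" for i using qt_separation that by blast
  have "part \<eta> i = part \<nu> i" for i
    using eq[of i] by (cases "i < N") (auto simp: N_def part_def)
  then have "mon \<eta> = mon \<nu>" by (intro poly_mapping_eqI) simp
  then show ?thesis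
    using assms mvals_mon partition_mset_inj by (metis is_partition_def)
qed

text \<open>Apart from restricting to N variables, phi_N only adds constants to the power sums, and
  these affect only monomials of degree below |\<kappa>|.\<close>

lemma lookup_phi_power_sums:
  assumes "0 \<notin> set \<kappa>" "Poly_Mapping.keys m \<subseteq> {..<N}" "sum_list \<kappa> \<le> mdeg m"
  shows "lkp (prod_list (map (phi_power_sum N) \<kappa>)) m = mcoeff (power_sums \<kappa>) m"
  using assms
proof (induction \<kappa> arbitrary: m)
  case Nil
  then show ?case by (simp add: lookup_one when_def)
next
  case (Cons n \<kappa>)
  then have n: "0 < n" by simp
  define g where "g = prod_list (map (phi_power_sum N) \<kappa>)"
  have "of_mpoly (phi_power_sum N n) = (\<Sum>i<N. mfps_monom (Poly_Mapping.single i n) 1) + mfps_const (t ^ (N * n) / (1 - t ^ n))"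
    by (simp add: phi_power_sum_def of_mpoly_hom of_mpoly_sum of_mpoly_single mpoly_const_def mfps_const_eq_monom)
  then have "lkp (phi_power_sum N n * g) m =
     (\<Sum>i<N. if n \<le> lkp m i then lkp g (m - Poly_Mapping.single i n) else 0) + t ^ (N * n) / (1 - t ^ n) * lkp g m"
    unfolding mcoeff_of_mpoly[symmetric] of_mpoly_mult
    by (simp add: distrib_right sum_distrib_right mcoeff_sum mcoeff_monom_mult monom_diff_add_iff cong: if_cong)
  \<comment> \<open>This is the factor of the added constant: m has degree at least n + |\<kappa>|,
    above the degree of the remaining product because n > 0.\<close>
  also have "lkp g m = 0"
  proof -
    have "lkp g m = mcoeff (power_sums \<kappa>) m" unfolding g_def using Cons by simp
    also have "\<dots> = 0" using power_sums_homogeneous[of \<kappa> m] Cons.prems n by auto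
    finally show ?thesis .
  qed
  also have "(\<Sum>i<N. if n \<le> lkp m i then lkp g (m - Poly_Mapping.single i n) else 0)
     = (\<Sum>i<N. if n \<le> lkp m i then mcoeff (power_sums \<kappa>) (m - Poly_Mapping.single i n) else 0)"
  proof (rule sum.cong[OF refl])
    fix i
    have "lkp g (m - Poly_Mapping.single i n) = mcoeff (power_sums \<kappa>) (m - Poly_Mapping.single i n)" if "n \<le> lkp m i"
      unfolding g_def
    proof (rule Cons.IH)
      show "Poly_Mapping.keys (m - Poly_Mapping.single i n) \<subseteq> {..<N}"
        using Cons.prems(2) by (auto simp: in_keys_iff lookup_minus subset_iff)
      show "sum_list \<kappa> \<le> mdeg (m - Poly_Mapping.single i n)"
        using Cons.prems(3) that by (simp add: mdeg_diff_single)
    qed (use Cons.prems in auto)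
    then show "(if n \<le> lkp m i then lkp g (m - Poly_Mapping.single i n) else 0) =
      (if n \<le> lkp m i then mcoeff (power_sums \<kappa>) (m - Poly_Mapping.single i n) else 0)" by simp
  qed
  also have "\<dots> = (\<Sum>i\<in>{i\<in>{..<N}. n \<le> lkp m i}. mcoeff (power_sums \<kappa>) (m - Poly_Mapping.single i n))"
    by (rule sum.inter_filter[symmetric]) simp
  also have "{i\<in>{..<N}. n \<le> lkp m i} = {i. n \<le> lkp m i}"
    using Cons.prems(2) n by (auto simp: subset_iff in_keys_iff)
  finally show ?case using n by (simp add: g_def mcoeff_power_sums_Cons)
qed

text \<open>A monomial of top degree in f survives unchanged in \<open>phi N f\<close> once its
  variables are among the first N. Hence a bound on the degrees of these polynomials for all large N
  bounds f itself.\<close>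

lemma p_coeffs_degree_le:
  assumes f: "f \<in> Sym" and deg: "\<And>N. N \<ge> N0 \<Longrightarrow> mpoly_degree (phi N f) \<le> d" and nz: "p_coeffs f \<rho> \<noteq> 0"
  shows "sum_list \<rho> \<le> d"
proof (rule ccontr)
  assume gt: "\<not> sum_list \<rho> \<le> d"
  have fh: "f \<in> Sym_hat" using f by (simp add: Sym_def)
  let ?S = "{\<kappa>. p_coeffs f \<kappa> \<noteq> 0}"
  note fin = finite_p_coeffs[OF f]
  define D where "D = Max (sum_list ` ?S)"
  have "D \<in> sum_list ` ?S" unfolding D_def using fin nz by (intro Max_in) auto
  then obtain \<kappa> where \<kappa>: "p_coeffs f \<kappa> \<noteq> 0" "sum_list \<kappa> = D" by auto
  have le: "sum_list \<sigma> \<le> D" if "p_coeffs f \<sigma> \<noteq> 0" for \<sigma>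
    unfolding D_def using fin that by (intro Max_ge) auto
  have Dd: "d < D" using le[OF nz] gt by simp
  obtain m where m: "mdeg m = D" "mcoeff f m \<noteq> 0"
    using p_coeffs_eq_0[OF fh, of \<kappa>] \<kappa> by auto
  define N where "N = max N0 (Suc (Max (insert 0 (Poly_Mapping.keys m))))"
  have km: "Poly_Mapping.keys m \<subseteq> {..<N}"
  proof
    fix i assume "i \<in> Poly_Mapping.keys m"
    then have "i \<le> Max (insert 0 (Poly_Mapping.keys m))" by (intro Max_ge) auto
    then show "i \<in> {..<N}" by (simp add: N_def)
  qed
  have part: "is_partition \<sigma>" if "p_coeffs f \<sigma> \<noteq> 0" for \<sigma>
    using that p_coeffs_non_partition[OF fh] by blast
  have "lkp (phi N f) m = (\<Sum>\<sigma>\<in>?S. p_coeffs f \<sigma> * lkp (prod_list (map (phi_power_sum N) \<sigma>)) m)"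
  proof -
    have "lkp (mpoly_const c * g) m = c * lkp g m" for c and g :: "qt mpoly"
      unfolding mcoeff_of_mpoly[symmetric] of_mpoly_mult mpoly_const_def of_mpoly_single mfps_const_eq_monom[symmetric]
      by simp
    then show ?thesis by (simp add: phi_def lookup_sum)
  qed
  also have "\<dots> = (\<Sum>\<sigma>\<in>?S. p_coeffs f \<sigma> * mcoeff (power_sums \<sigma>) m)"
    using part le km m by (intro sum.cong refl arg_cong2[of _ _ _ _ "(*)"] lookup_phi_power_sums) (auto simp: is_partition_def)
  also have "\<dots> = (\<Sum>\<sigma>\<in>?S \<union> {\<sigma>. is_partition \<sigma> \<and> sum_list \<sigma> = mdeg m}. p_coeffs f \<sigma> * mcoeff (power_sums \<sigma>) m)"
    using fin finite_partitions by (intro sum.mono_neutral_left) auto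
  also have "\<dots> = (\<Sum>\<sigma>\<in>{\<sigma>. is_partition \<sigma> \<and> sum_list \<sigma> = mdeg m}. p_coeffs f \<sigma> * mcoeff (power_sums \<sigma>) m)"
  proof (rule sum.mono_neutral_right)
    show "\<forall>\<sigma>\<in>?S \<union> {\<sigma>. is_partition \<sigma> \<and> sum_list \<sigma> = mdeg m} - {\<sigma>. is_partition \<sigma> \<and> sum_list \<sigma> = mdeg m}.
       p_coeffs f \<sigma> * mcoeff (power_sums \<sigma>) m = 0"
      using power_sums_homogeneous part by (fastforce simp: is_partition_def)
  qed (use fin finite_partitions in auto)
  also have "\<dots> = mcoeff f m" using p_expansionD[OF p_expansion_p_coeffs[OF fh]] by simp
  finally have "m \<in> Poly_Mapping.keys (phi N f)" using m by (simp add: in_keys_iff)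
  then have "mdeg m \<le> mpoly_degree (phi N f)" unfolding mpoly_degree_def by (intro Max_ge) auto
  also have "\<dots> \<le> d" by (rule deg) (simp add: N_def)
  finally show False using m Dd by simp
qed

section \<open>The dual functions as combinations of kernels\<close>

text \<open>The scalar square of the power sum product, that is, the diagonal Gram entry of the
  pairing.\<close>

definition mac_weight :: "nat list \<Rightarrow> qt" where
  "mac_weight \<kappa> = of_nat (z_part \<kappa>) * (\<Prod>k\<leftarrow>\<kappa>. (1 - q ^ k) / (1 - t ^ k))"

text \<open>An enumeration of S turns the families into square matrices over a field, for which a
  one-sided inverse is two-sided.\<close>

lemma left_inverse_imp_right_inverse_on:
  fixes A B :: "'b \<Rightarrow> 'b \<Rightarrow> 'a::field"
  assumes S: "finite S"
    and AB: "\<And>i j. i \<in> S \<Longrightarrow> j \<in> S \<Longrightarrow> (\<Sum>k\<in>S. A i k * B k j) = (if i = j then 1 else 0)"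
    and ij: "i \<in> S" "j \<in> S"
  shows "(\<Sum>k\<in>S. B i k * A k j) = (if i = j then 1 else 0)"
proof -
  define n where "n = card S"
  obtain e where e: "bij_betw e {0..<n} S"
    using ex_bij_betw_nat_finite[OF S] n_def by blast
  have inj: "e i = e j \<longleftrightarrow> i = j" if "i < n" "j < n" for i j
    using bij_betw_imp_inj_on[OF e] that by (auto simp: inj_on_def)
  have eS: "e i \<in> S" if "i < n" for i
    using e that by (auto simp: bij_betw_def)
  define MA where "MA = mat n n (\<lambda>(i, j). A (e i) (e j))"
  define MB where "MB = mat n n (\<lambda>(i, j). B (e i) (e j))"
  have prod: "(mat n n (\<lambda>(i, j). F (e i) (e j)) * mat n n (\<lambda>(i, j). G (e i) (e j))) $$ (i, j)
      = (\<Sum>k\<in>S. F (e i) k * G k (e j))" if "i < n" "j < n" for F G :: "'b \<Rightarrow> 'b \<Rightarrow> 'a" and i j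
    using that by (simp add: scalar_prod_def sum.reindex_bij_betw[OF e, of "\<lambda>k. F (e i) k * G k (e j)"])
  have "MA * MB = 1\<^sub>m n"
  proof (rule eq_matI)
    fix i j assume "i < dim_row (1\<^sub>m n :: 'a mat)" "j < dim_col (1\<^sub>m n :: 'a mat)"
    then have ij: "i < n" "j < n" by auto
    have "(MA * MB) $$ (i, j) = (\<Sum>k\<in>S. A (e i) k * B k (e j))"
      unfolding MA_def MB_def using ij by (rule prod)
    then show "(MA * MB) $$ (i, j) = (1\<^sub>m n :: 'a mat) $$ (i, j)"
      using ij by (simp add: AB eS inj)
  qed (auto simp: MA_def MB_def)
  then have BA: "MB * MA = 1\<^sub>m n"
    by (rule mat_mult_left_right_inverse[rotated 2]) (auto simp: MA_def MB_def)
  obtain i' j' where ij': "i' < n" "j' < n" "i = e i'" "j = e j'"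
    using e ij unfolding bij_betw_def by (metis (no_types, lifting) atLeastLessThan_iff imageE)
  have "(\<Sum>k\<in>S. B i k * A k j) = (MB * MA) $$ (i', j')"
    unfolding ij' MA_def MB_def using ij' prod[of i' j' B A] by simp
  also have "\<dots> = (if i = j then 1 else 0)"
    unfolding BA using ij' inj by auto
  finally show ?thesis .
qed

text \<open>By linearity the relation holds with any polynomial in place of the powers. The
  polynomial g with roots at all the \<open>w \<nu>\<close> makes the right side 0, while its value
  at v is a product of nonzero differences.\<close>

lemma power_sequence_not_combination:
  fixes v :: "'a::idom"
  assumes T: "finite T" and comb: "\<And>k. v ^ k = (\<Sum>\<nu>\<in>T. D \<nu> * w \<nu> ^ k)" 
  shows "v \<in> w ` T"
proof (rule ccontr)
  assume v: "v \<notin> w ` T"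
  define g where "g = (\<Prod>\<nu>\<in>T. [:- w \<nu>, 1:])"
  have "poly g v = (\<Sum>k\<le>degree g. coeff g k * (\<Sum>\<nu>\<in>T. D \<nu> * w \<nu> ^ k))"
    by (simp add: poly_altdef flip: comb)
  also have "\<dots> = (\<Sum>\<nu>\<in>T. D \<nu> * poly g (w \<nu>))"
    unfolding poly_altdef sum_distrib_left by (subst sum.swap) (simp add: mult_ac)
  also have "\<dots> = 0"
  proof (rule sum.neutral, rule ballI)
    fix \<nu> assume "\<nu> \<in> T"
    then have "poly g (w \<nu>) = 0" using T by (auto simp: g_def poly_prod)
    then show "D \<nu> * poly g (w \<nu>) = 0" by simp
  qed
  finally have "(\<Prod>\<nu>\<in>T. v - w \<nu>) = 0" by (simp add: g_def poly_prod)
  then show False using v T by auto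
qed

abbreviation parts_le :: "nat \<Rightarrow> nat list set" where
  "parts_le n \<equiv> {\<kappa>. is_partition \<kappa> \<and> sum_list \<kappa> \<le> n}"

definition spec_value :: "nat list \<Rightarrow> qt mfps \<Rightarrow> qt" where
  "spec_value \<eta> f = (\<Sum>\<rho> | p_coeffs f \<rho> \<noteq> 0. p_coeffs f \<rho> * spec_list \<eta> \<rho>)"

lemma interpolation_functions_degree:
  assumes I: "interpolation_functions P I" and \<kappa>: "is_partition \<kappa>" and nz: "p_coeffs (I \<kappa>) \<rho> \<noteq> 0"
  shows "is_partition \<rho>" "sum_list \<rho> \<le> sum_list \<kappa>"
proof -
  have Sym: "I \<kappa> \<in> Sym" using I \<kappa> by (auto simp: interpolation_functions_def)
  show "sum_list \<rho> \<le> sum_list \<kappa>"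
  proof (rule p_coeffs_degree_le[OF Sym _ nz])
    show "mpoly_degree (phi N (I \<kappa>)) \<le> sum_list \<kappa>" if "N \<ge> length \<kappa>" for N
      using I \<kappa> that by (simp add: interpolation_functions_def interpolation_polynomial_def)
  qed
  show "is_partition \<rho>" using nz p_coeffs_non_partition[of "I \<kappa>" \<rho>] Sym by (auto simp: Sym_def)
qed

lemma interpolation_functions_vanishing:
  assumes I: "interpolation_functions P I" and \<kappa>: "is_partition \<kappa>" and \<eta>: "is_partition \<eta>"
    and le: "sum_list \<eta> \<le> sum_list \<kappa>" "\<eta> \<noteq> \<kappa>"
  shows "spec_value \<eta> (I \<kappa>) = 0"
proof -
  define N where "N = max (length \<eta>) (length \<kappa>)"
  have Sym: "I \<kappa> \<in> Sym_hat" using I \<kappa> by (auto simp: interpolation_functions_def Sym_def)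
  have "interpolation_polynomial P N \<kappa> (phi N (I \<kappa>))"
    using I \<kappa> by (simp add: interpolation_functions_def N_def)
  then have "mpoly_eval (X_point \<eta>) (phi N (I \<kappa>)) = 0"
    using \<eta> le by (simp add: interpolation_polynomial_def N_def)
  then show ?thesis using eval_phi[OF _ Sym, of \<eta> N] by (simp add: spec_value_def N_def)
qed

text \<open>This is the coefficient at \<sigma> of the kernel identity, multiplied by the weight of
  \<sigma>. In the truncation to size d, duality reads AB = 1; the row \<sigma> of BA = 1 is then
  summed against the values at \<eta> of the power sum products.\<close>

lemma reproducing_identity:
  assumes I: "interpolation_functions P I" and H: "dual_functions I H"
    and \<eta>: "is_partition \<eta>" and \<sigma>: "is_partition \<sigma>"
  shows "spec_list \<eta> \<sigma> = (\<Sum>\<kappa> | is_partition \<kappa> \<and> (sum_list \<kappa> < sum_list \<eta> \<or> \<kappa> = \<eta>).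
    spec_value \<eta> (I \<kappa>) * (mac_weight \<sigma> * p_coeffs (H \<kappa>) \<sigma>))"
proof -
  \<comment> \<open>The truncation must contain \<sigma>, whose row is used, and all indices
    \<kappa> that survive the vanishing conditions for \<eta>.\<close>
  define d where "d = max (sum_list \<eta>) (sum_list \<sigma>)"
  define A where "A = (\<lambda>\<kappa>. p_coeffs (I \<kappa>))"
  define B where "B = (\<lambda>\<rho> \<kappa>. mac_weight \<rho> * p_coeffs (H \<kappa>) \<rho>)"
  have fin: "finite (parts_le d)" by (rule finite_partitions_le)
  have sub: "{\<rho>. A \<kappa> \<rho> \<noteq> 0} \<subseteq> parts_le d" if "\<kappa> \<in> parts_le d" for \<kappa>
    using interpolation_functions_degree[OF I, of \<kappa>] that unfolding A_def by force
  have AB: "(\<Sum>\<rho>\<in>parts_le d. A \<kappa> \<rho> * B \<rho> \<nu>) = (if \<kappa> = \<nu> then 1 else 0)"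
    if "\<kappa> \<in> parts_le d" "\<nu> \<in> parts_le d" for \<kappa> \<nu>
  proof -
    have "(if \<kappa> = \<nu> then 1 else 0) = mac_pairing (I \<kappa>) (H \<nu>)"
      using H that by (simp add: dual_functions_def)
    also have "\<dots> = (\<Sum>\<rho> | A \<kappa> \<rho> \<noteq> 0. A \<kappa> \<rho> * B \<rho> \<nu>)"
      by (simp add: mac_pairing_def A_def B_def mac_weight_def mult_ac)
    also have "\<dots> = (\<Sum>\<rho>\<in>parts_le d. A \<kappa> \<rho> * B \<rho> \<nu>)"
      using sub that fin by (intro sum.mono_neutral_left) auto
    finally show ?thesis by simp
  qed
  have BA: "(\<Sum>\<kappa>\<in>parts_le d. B \<sigma> \<kappa> * A \<kappa> \<rho>) = (if \<sigma> = \<rho> then 1 else 0)" if "\<rho> \<in> parts_le d" for \<rho>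
    using left_inverse_imp_right_inverse_on[OF fin AB, of \<sigma> \<rho>] that \<sigma> by (simp add: d_def)
  have val: "spec_value \<eta> (I \<kappa>) = (\<Sum>\<rho>\<in>parts_le d. A \<kappa> \<rho> * spec_list \<eta> \<rho>)" if "\<kappa> \<in> parts_le d" for \<kappa>
    unfolding spec_value_def A_def
    by (rule sum.mono_neutral_left[OF fin sub[OF that, unfolded A_def]]) simp
  have "(\<Sum>\<kappa>\<in>parts_le d. spec_value \<eta> (I \<kappa>) * B \<sigma> \<kappa>)
      = (\<Sum>\<kappa>\<in>parts_le d. \<Sum>\<rho>\<in>parts_le d. spec_list \<eta> \<rho> * (B \<sigma> \<kappa> * A \<kappa> \<rho>))"
    by (rule sum.cong[OF refl], subst val) (auto simp: sum_distrib_left mult_ac)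
  also have "\<dots> = (\<Sum>\<rho>\<in>parts_le d. spec_list \<eta> \<rho> * (\<Sum>\<kappa>\<in>parts_le d. B \<sigma> \<kappa> * A \<kappa> \<rho>))"
    by (subst sum.swap) (simp add: sum_distrib_left)
  also have "\<dots> = (\<Sum>\<rho>\<in>parts_le d. if \<sigma> = \<rho> then spec_list \<eta> \<rho> else 0)"
    by (intro sum.cong refl) (simp add: BA)
  also have "\<dots> = spec_list \<eta> \<sigma>"
    using fin \<sigma> by (simp add: d_def)
  \<comment> \<open>Here the dependence on d, and with it on \<sigma>, disappears from the index
    set.\<close>
  also have "(\<Sum>\<kappa>\<in>parts_le d. spec_value \<eta> (I \<kappa>) * B \<sigma> \<kappa>) =
    (\<Sum>\<kappa> | is_partition \<kappa> \<and> (sum_list \<kappa> < sum_list \<eta> \<or> \<kappa> = \<eta>). spec_value \<eta> (I \<kappa>) * B \<sigma> \<kappa>)"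
  proof (rule sum.mono_neutral_right[OF fin])
    show "{\<kappa>. is_partition \<kappa> \<and> (sum_list \<kappa> < sum_list \<eta> \<or> \<kappa> = \<eta>)} \<subseteq> parts_le d"
      by (auto simp: d_def)
    show "\<forall>\<kappa>\<in>parts_le d - {\<kappa>. is_partition \<kappa> \<and> (sum_list \<kappa> < sum_list \<eta> \<or> \<kappa> = \<eta>)}.
       spec_value \<eta> (I \<kappa>) * B \<sigma> \<kappa> = 0"
      using interpolation_functions_vanishing[OF I _ \<eta>] by force
  qed
  finally show ?thesis by (simp add: B_def)
qed

text \<open>The reproducing identity is solved for its term \<kappa> = \<eta>, the other terms being
  known by induction on the size. The constants are quantified before \<sigma>, since only a choice
  uniform in \<sigma> yields an identity of series.\<close>

lemma dual_functions_span:
  assumes I: "interpolation_functions P I" and H: "dual_functions I H" and \<eta>: "is_partition \<eta>"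
  shows "\<exists>C. \<forall>\<sigma>. is_partition \<sigma> \<longrightarrow>
    mac_weight \<sigma> * p_coeffs (H \<eta>) \<sigma> = (\<Sum>\<nu>\<in>parts_le (sum_list \<eta>). C \<nu> * spec_list \<nu> \<sigma>)"
  using \<eta>
proof (induction "sum_list \<eta>" arbitrary: \<eta> rule: less_induct)
  case less
  define B where "B = (\<lambda>\<rho> \<kappa>. mac_weight \<rho> * p_coeffs (H \<kappa>) \<rho>)"
  define T where "T = {\<kappa>. is_partition \<kappa> \<and> sum_list \<kappa> < sum_list \<eta>}"
  have finT: "finite T"
    unfolding T_def by (rule finite_subset[OF _ finite_partitions_le[of "sum_list \<eta>"]]) auto
  have parts: "parts_le (sum_list \<eta>) = T \<union> {\<kappa>. is_partition \<kappa> \<and> sum_list \<kappa> = sum_list \<eta>}"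
    by (auto simp: T_def)
  have "\<forall>\<kappa>\<in>T. \<exists>C. \<forall>\<sigma>. is_partition \<sigma> \<longrightarrow>
      B \<sigma> \<kappa> = (\<Sum>\<nu>\<in>parts_le (sum_list \<kappa>). C \<nu> * spec_list \<nu> \<sigma>)"
    unfolding B_def by (rule ballI, rule less.hyps) (auto simp: T_def)
  from bchoice[OF this] obtain C where C0: "\<forall>\<kappa>\<in>T. \<forall>\<sigma>. is_partition \<sigma> \<longrightarrow>
      B \<sigma> \<kappa> = (\<Sum>\<nu>\<in>parts_le (sum_list \<kappa>). C \<kappa> \<nu> * spec_list \<nu> \<sigma>)" ..
  have C: "B \<sigma> \<kappa> = (\<Sum>\<nu>\<in>parts_le (sum_list \<kappa>). C \<kappa> \<nu> * spec_list \<nu> \<sigma>)"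
    if "\<kappa> \<in> T" "is_partition \<sigma>" for \<kappa> \<sigma>
    using C0 that by simp
  \<comment> \<open>Padding with zeros gives all \<kappa> the same index set T, so that the double
    sum can be interchanged.\<close>
  have C': "B \<sigma> \<kappa> = (\<Sum>\<nu>\<in>T. (if sum_list \<nu> \<le> sum_list \<kappa> then C \<kappa> \<nu> else 0) * spec_list \<nu> \<sigma>)"
    if "\<kappa> \<in> T" "is_partition \<sigma>" for \<kappa> \<sigma>
    unfolding C[OF that] using that finT
    by (intro sum.mono_neutral_cong_left) (auto simp: T_def)
  define D where "D = (\<lambda>\<nu>. \<Sum>\<kappa>\<in>T. spec_value \<eta> (I \<kappa>) * (if sum_list \<nu> \<le> sum_list \<kappa> then C \<kappa> \<nu> else 0))"
  have key: "spec_list \<eta> \<sigma> = spec_value \<eta> (I \<eta>) * B \<sigma> \<eta> + (\<Sum>\<nu>\<in>T. D \<nu> * spec_list \<nu> \<sigma>)"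
    if \<sigma>: "is_partition \<sigma>" for \<sigma>
  proof -
    have "{\<kappa>. is_partition \<kappa> \<and> (sum_list \<kappa> < sum_list \<eta> \<or> \<kappa> = \<eta>)} = insert \<eta> T"
      using less.prems by (auto simp: T_def)
    then have "spec_list \<eta> \<sigma> = (\<Sum>\<kappa>\<in>insert \<eta> T. spec_value \<eta> (I \<kappa>) * B \<sigma> \<kappa>)"
      using reproducing_identity[OF I H less.prems \<sigma>] by (simp add: B_def)
    also have "\<dots> = spec_value \<eta> (I \<eta>) * B \<sigma> \<eta> + (\<Sum>\<kappa>\<in>T. spec_value \<eta> (I \<kappa>) * B \<sigma> \<kappa>)"
      using finT by (simp add: T_def)
    also have "(\<Sum>\<kappa>\<in>T. spec_value \<eta> (I \<kappa>) * B \<sigma> \<kappa>) = (\<Sum>\<kappa>\<in>T. \<Sum>\<nu>\<in>T.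
        spec_value \<eta> (I \<kappa>) * (if sum_list \<nu> \<le> sum_list \<kappa> then C \<kappa> \<nu> else 0) * spec_list \<nu> \<sigma>)"
      by (intro sum.cong refl) (simp only: C' \<sigma> sum_distrib_left mult.assoc)
    also have "\<dots> = (\<Sum>\<nu>\<in>T. D \<nu> * spec_list \<nu> \<sigma>)"
      by (subst sum.swap) (simp only: D_def sum_distrib_right)
    finally show ?thesis .
  qed
  have nz: "spec_value \<eta> (I \<eta>) \<noteq> 0"
  proof
    assume "spec_value \<eta> (I \<eta>) = 0"
    \<comment> \<open>On columns the value of the power sum product is the k-th power of the value
      of p_1, so these partitions alone contradict the independence of power sequences.\<close>
    moreover have "is_partition (replicate k 1)" for k
      by (auto simp: is_partition_def sorted_wrt_iff_nth_less)
    ultimately have "spec \<eta> 1 ^ k = (\<Sum>\<nu>\<in>T. D \<nu> * spec \<nu> 1 ^ k)" for k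
      using key[of "replicate k 1"] by (simp add: spec_list_def)
    then have "spec \<eta> 1 \<in> (\<lambda>\<nu>. spec \<nu> 1) ` T"
      by (rule power_sequence_not_combination[OF finT])
    then show False using spec_1_inj[OF less.prems] by (auto simp: T_def)
  qed
  \<comment> \<open>These constants come from dividing \<open>key\<close> by the nonzero value of
    I_\<eta> at \<eta>; other partitions of the size of \<eta> receive 0.\<close>
  define E where "E = (\<lambda>\<nu>. if \<nu> = \<eta> then 1 / spec_value \<eta> (I \<eta>) else if \<nu> \<in> T then - D \<nu> / spec_value \<eta> (I \<eta>) else 0)"
  have "B \<sigma> \<eta> = (\<Sum>\<nu>\<in>parts_le (sum_list \<eta>). E \<nu> * spec_list \<nu> \<sigma>)" if \<sigma>: "is_partition \<sigma>" for \<sigma>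
  proof -
    have "(\<Sum>\<nu>\<in>parts_le (sum_list \<eta>). E \<nu> * spec_list \<nu> \<sigma>) = (\<Sum>\<nu>\<in>insert \<eta> T. E \<nu> * spec_list \<nu> \<sigma>)"
      using less.prems by (intro sum.mono_neutral_right finite_partitions_le) (auto simp: T_def E_def)
    also have "\<dots> = spec_list \<eta> \<sigma> / spec_value \<eta> (I \<eta>) + (\<Sum>\<nu>\<in>T. E \<nu> * spec_list \<nu> \<sigma>)"
      using finT by (simp add: T_def E_def)
    also have "(\<Sum>\<nu>\<in>T. E \<nu> * spec_list \<nu> \<sigma>) = (\<Sum>\<nu>\<in>T. - (D \<nu> * spec_list \<nu> \<sigma>) / spec_value \<eta> (I \<eta>))"
      by (intro sum.cong refl) (auto simp: E_def T_def)
    also have "spec_list \<eta> \<sigma> / spec_value \<eta> (I \<eta>) + \<dots> = B \<sigma> \<eta>"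
      using nz by (subst key[OF \<sigma>]) (simp add: add_divide_distrib sum_negf flip: sum_divide_distrib)
    finally show ?thesis by simp
  qed
  then show ?case unfolding B_def by blast
qed

section \<open>Kernels as products over the variables\<close>

lemma sorted_wrt_remove1: "sorted_wrt R xs \<Longrightarrow> sorted_wrt R (remove1 x xs)"
  by (induction xs) (auto dest: notin_set_remove1 set_remove1_subset[THEN subsetD])

text \<open>The factor lost with one part n is n times its multiplicity. Summed over the distinct
  parts these factors give the size of the partition, which produces the degree in Euler's
  identity.\<close>

lemma z_part_remove1:
  assumes n: "n \<in> set \<tau>"
  shows "z_part \<tau> = n * count_list \<tau> n * z_part (remove1 n \<tau>)"
proof -
  let ?f = "\<lambda>\<tau> i. i ^ count_list \<tau> i * fact (count_list \<tau> i) :: nat"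
  have cnt: "count_list (remove1 n \<tau>) i = (if i = n then count_list \<tau> n - 1 else count_list \<tau> i)" for i
    by (simp flip: count_mset)
  have pos: "count_list \<tau> n = Suc (count_list \<tau> n - 1)"
    using n by (metis Suc_pred' count_list_0_iff gr0I)
  have "?f (remove1 n \<tau>) i = 1" if "i \<notin> set (remove1 n \<tau>)" for i
    unfolding count_notin[OF that] by simp
  then have "z_part (remove1 n \<tau>) = (\<Prod>i\<in>set \<tau>. ?f (remove1 n \<tau>) i)"
    unfolding z_part_def using set_remove1_subset[of n \<tau>]
    by (intro prod.mono_neutral_left) blast+
  also have "\<dots> = ?f (remove1 n \<tau>) n * (\<Prod>i\<in>set \<tau> - {n}. ?f (remove1 n \<tau>) i)"
    using n by (simp add: prod.remove)
  also have "(\<Prod>i\<in>set \<tau> - {n}. ?f (remove1 n \<tau>) i) = (\<Prod>i\<in>set \<tau> - {n}. ?f \<tau> i)"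
    by (intro prod.cong refl) (auto simp: cnt)
  finally have 1: "z_part (remove1 n \<tau>) = ?f (remove1 n \<tau>) n * (\<Prod>i\<in>set \<tau> - {n}. ?f \<tau> i)" .
  have "?f \<tau> n = n * count_list \<tau> n * ?f (remove1 n \<tau>) n"
    by (subst (1 2 3) pos) (simp add: cnt algebra_simps)
  moreover have "z_part \<tau> = ?f \<tau> n * (\<Prod>i\<in>set \<tau> - {n}. ?f \<tau> i)"
    unfolding z_part_def using n by (simp add: prod.remove)
  ultimately show ?thesis using 1 by simp
qed

lemma z_part_pos: "0 \<notin> set \<tau> \<Longrightarrow> 0 < z_part \<tau>"
  unfolding z_part_def by (rule prod_pos) (auto intro: gr0I)

lemma z_part_Nil [simp]: "z_part [] = 1"
  by (simp add: z_part_def)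

text \<open>The coefficient at m of the exponential of the sum of a_n p_n / n, in its classical
  expansion with denominators z_\<sigma>. Given in this form, it needs no exponential of
  multivariate series.\<close>

definition p_exp :: "(nat \<Rightarrow> qt) \<Rightarrow> monom \<Rightarrow> qt" where
  "p_exp a m = (\<Sum>\<sigma> | is_partition \<sigma> \<and> sum_list \<sigma> = mdeg m.
     prod_list (map a \<sigma>) / of_nat (z_part \<sigma>) * mcoeff (power_sums \<sigma>) m)"

lemma p_exp_0: "p_exp a 0 = 1"
proof -
  have "{\<sigma>. is_partition \<sigma> \<and> sum_list \<sigma> = mdeg 0} = {[]}"
  proof safe
    fix \<sigma> assume "is_partition \<sigma>" "sum_list \<sigma> = mdeg 0"
    then show "\<sigma> = []"
      using length_le_sum_list[of \<sigma>] by (metis is_partition_def le_zero_eq length_0_conv mdeg_zero)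
  qed (auto simp: is_partition_def)
  then show ?thesis by (simp add: p_exp_def)
qed

text \<open>Euler's operator, which multiplies a monomial by its degree, is a derivation; applied to
  \<open>exp (\<Sum>\<^sub>n a\<^sub>n p\<^sub>n / n)\<close> it gives \<open>\<Sum>\<^sub>n a\<^sub>n p\<^sub>n\<close> times the same exponential.\<close>

lemma p_exp_euler:
  "of_nat (mdeg m) * p_exp a m =
    (\<Sum>n\<in>{1..mdeg m}. \<Sum>i | n \<le> lkp m i. a n * p_exp a (m - Poly_Mapping.single i n))"
proof -
  define d where "d = mdeg m"
  define Pt where "Pt = (\<lambda>d. {\<sigma>. is_partition \<sigma> \<and> sum_list \<sigma> = d})"
  have fin: "finite (Pt d)" for d unfolding Pt_def by (rule finite_partitions)
  define w where "w = (\<lambda>\<sigma>. prod_list (map a \<sigma>))"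
  define ins where "ins = (\<lambda>n \<rho>. rev (insort n (rev \<rho>)) :: nat list)"
  have mset_ins: "mset (ins n \<rho>) = mset (n # \<rho>)" for n \<rho> by (simp add: ins_def)
  have part_ins: "is_partition (ins n \<rho>)" if "is_partition \<rho>" "0 < n" for n \<rho>
  proof -
    have "sorted (rev \<rho>)" using that by (simp add: is_partition_def sorted_wrt_rev)
    then have "sorted (insort n (rev \<rho>))" by (rule sorted_insort[THEN iffD2])
    moreover have "set (ins n \<rho>) = insert n (set \<rho>)" by (auto simp: ins_def set_insort_key)
    ultimately show ?thesis using that by (auto simp: is_partition_def ins_def sorted_wrt_rev)
  qed
  have part_rem: "is_partition (remove1 n \<tau>)" if "is_partition \<tau>" for n \<tau>
    using that by (auto simp: is_partition_def sorted_wrt_remove1 dest: notin_set_remove1)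
  have sum_ins: "sum_list (ins n \<rho>) = n + sum_list \<rho>" for n \<rho>
    using mset_ins[of n \<rho>] by (metis sum_list.Cons sum_mset_sum_list)
  have sum_rem: "sum_list (remove1 n \<tau>) = sum_list \<tau> - n" if "n \<in> set \<tau>" for n and \<tau> :: "nat list"
  proof -
    have "sum_list \<tau> = n + sum_list (remove1 n \<tau>)" using that by (induction \<tau>) auto
    then show ?thesis by simp
  qed
  have ins_rem: "ins n (remove1 n \<tau>) = \<tau>" if "is_partition \<tau>" "n \<in> set \<tau>" for n \<tau>
  proof (rule partition_mset_inj[OF part_ins[OF part_rem[OF that(1)]] that(1)])
    show "0 < n" using that by (metis gr0I is_partition_def)
    show "mset (ins n (remove1 n \<tau>)) = mset \<tau>" unfolding mset_ins using that(2) by simp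
  qed
  have rem_ins: "remove1 n (ins n \<rho>) = \<rho>" if "is_partition \<rho>" "0 < n" for n \<rho>
    by (rule partition_mset_inj[OF part_rem[OF part_ins[OF that]] that(1)]) (simp add: mset_ins)
  have "(\<Sum>i | n \<le> lkp m i. a n * p_exp a (m - Poly_Mapping.single i n)) =
      (\<Sum>\<rho>\<in>Pt (d - n). w (ins n \<rho>) / of_nat (z_part \<rho>) * mcoeff (power_sums (ins n \<rho>)) m)"
    if n: "n \<in> {1..d}" for n
  proof -
    have "(\<Sum>i | n \<le> lkp m i. a n * p_exp a (m - Poly_Mapping.single i n)) =
       (\<Sum>i | n \<le> lkp m i. \<Sum>\<rho>\<in>Pt (d - n). a n * w \<rho> / of_nat (z_part \<rho>) * mcoeff (power_sums \<rho>) (m - Poly_Mapping.single i n))"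
      by (intro sum.cong refl) (simp add: p_exp_def mdeg_diff_single sum_distrib_left mult.assoc Pt_def d_def w_def)
    also have "\<dots> = (\<Sum>\<rho>\<in>Pt (d - n). a n * w \<rho> / of_nat (z_part \<rho>) * mcoeff (power_sums (n # \<rho>)) m)"
      using n by (subst sum.swap) (simp add: mcoeff_power_sums_Cons sum_distrib_left)
    also have "\<dots> = (\<Sum>\<rho>\<in>Pt (d - n). w (ins n \<rho>) / of_nat (z_part \<rho>) * mcoeff (power_sums (ins n \<rho>)) m)"
    proof (rule sum.cong[OF refl])
      fix \<rho>
      have "w (ins n \<rho>) = a n * w \<rho>"
        using mset_ins[of n \<rho>] unfolding w_def by (metis list.simps(9) mset_map prod_list.Cons prod_mset_prod_list)
      moreover have "power_sums (ins n \<rho>) = power_sums (n # \<rho>)"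
        by (rule power_sums_mset_cong[OF mset_ins])
      ultimately show "a n * w \<rho> / of_nat (z_part \<rho>) * mcoeff (power_sums (n # \<rho>)) m =
         w (ins n \<rho>) / of_nat (z_part \<rho>) * mcoeff (power_sums (ins n \<rho>)) m" by simp
    qed
    finally show ?thesis .
  qed
  then have "(\<Sum>n\<in>{1..d}. \<Sum>i | n \<le> lkp m i. a n * p_exp a (m - Poly_Mapping.single i n)) =
     (\<Sum>n\<in>{1..d}. \<Sum>\<rho>\<in>Pt (d - n). w (ins n \<rho>) / of_nat (z_part \<rho>) * mcoeff (power_sums (ins n \<rho>)) m)"
    by (rule sum.cong[OF refl])
  also have "\<dots> = (\<Sum>(n, \<rho>)\<in>(SIGMA n:{1..d}. Pt (d - n)). w (ins n \<rho>) / of_nat (z_part \<rho>) * mcoeff (power_sums (ins n \<rho>)) m)"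
    by (rule sum.Sigma) (auto simp: fin)
  \<comment> \<open>Inserting n into a partition of d - n and marking it is inverse to removing a
    marked part value from a partition of d.\<close>
  also have "\<dots> = (\<Sum>(\<tau>, n)\<in>(SIGMA \<tau>:Pt d. set \<tau>). w \<tau> / of_nat (z_part (remove1 n \<tau>)) * mcoeff (power_sums \<tau>) m)"
  proof (rule sum.reindex_bij_witness[of _ "\<lambda>(\<tau>, n). (n, remove1 n \<tau>)" "\<lambda>(n, \<rho>). (ins n \<rho>, n)"], goal_cases)
    case (2 x)
    obtain n \<rho> where x: "x = (n, \<rho>)" by fastforce
    have "n \<in> set (ins n \<rho>)" using mset_ins[of n \<rho>] by (metis list.set_intros(1) set_mset_mset)
    then show ?case using 2 x by (auto simp: Pt_def part_ins sum_ins)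
  next
    case (4 y)
    obtain \<tau> n where y: "y = (\<tau>, n)" by fastforce
    then have "n \<in> set \<tau>" "is_partition \<tau>" "sum_list \<tau> = d" using 4 by (auto simp: Pt_def)
    moreover from this have "0 < n" by (auto simp: is_partition_def intro: gr0I)
    moreover have "n \<le> d" using calculation member_le_sum_list[of n \<tau>] by simp
    ultimately show ?case using y by (simp add: Pt_def part_rem sum_rem)
  qed (auto simp: Pt_def rem_ins ins_rem)
  also have "\<dots> = (\<Sum>\<tau>\<in>Pt d. \<Sum>n\<in>set \<tau>. w \<tau> / of_nat (z_part (remove1 n \<tau>)) * mcoeff (power_sums \<tau>) m)"
    by (rule sum.Sigma[symmetric]) (auto simp: fin)
  also have "\<dots> = (\<Sum>\<tau>\<in>Pt d. of_nat d * (w \<tau> / of_nat (z_part \<tau>) * mcoeff (power_sums \<tau>) m))"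
  proof (rule sum.cong[OF refl])
    fix \<tau> assume \<tau>: "\<tau> \<in> Pt d"
    then have nz: "0 \<notin> set \<tau>" by (simp add: Pt_def is_partition_def)
    have "(\<Sum>n\<in>set \<tau>. w \<tau> / of_nat (z_part (remove1 n \<tau>)) * mcoeff (power_sums \<tau>) m) =
      (\<Sum>n\<in>set \<tau>. of_nat (count_list \<tau> n * n) * (w \<tau> / of_nat (z_part \<tau>) * mcoeff (power_sums \<tau>) m))"
    proof (rule sum.cong[OF refl])
      fix n assume n: "n \<in> set \<tau>"
      have z: "z_part \<tau> \<noteq> 0" using z_part_pos[OF nz] by simp
      then have "(of_nat n :: qt) \<noteq> 0" "(of_nat (count_list \<tau> n) :: qt) \<noteq> 0" "(of_nat (z_part (remove1 n \<tau>)) :: qt) \<noteq> 0"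
        unfolding of_nat_eq_0_iff z_part_remove1[OF n] by auto
      then show "w \<tau> / of_nat (z_part (remove1 n \<tau>)) * mcoeff (power_sums \<tau>) m =
        of_nat (count_list \<tau> n * n) * (w \<tau> / of_nat (z_part \<tau>) * mcoeff (power_sums \<tau>) m)"
        unfolding z_part_remove1[OF n] by simp
    qed
    also have "\<dots> = of_nat (\<Sum>n\<in>set \<tau>. count_list \<tau> n * n) * (w \<tau> / of_nat (z_part \<tau>) * mcoeff (power_sums \<tau>) m)"
      by (simp only: of_nat_sum sum_distrib_right)
    also have "(\<Sum>n\<in>set \<tau>. count_list \<tau> n * n) = d"
      using \<tau> sum_list_map_eq_sum_count[of "\<lambda>x. x" \<tau>] by (simp add: Pt_def)
    finally show "(\<Sum>n\<in>set \<tau>. w \<tau> / of_nat (z_part (remove1 n \<tau>)) * mcoeff (power_sums \<tau>) m) =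
      of_nat d * (w \<tau> / of_nat (z_part \<tau>) * mcoeff (power_sums \<tau>) m)" .
  qed
  also have "\<dots> = of_nat (mdeg m) * p_exp a m"
    by (simp add: p_exp_def sum_distrib_left Pt_def w_def d_def)
  finally show ?thesis by (simp add: d_def)
qed

text \<open>G gives the coefficients of the product of F(y_i) over all variables. Each variable
  contributes its own logarithmic derivative, so G obeys the same recursion as
  \<open>p_exp\<close>.\<close>

lemma prod_coeff_euler:
  fixes F :: "qt fps"
  assumes F0: "fps_nth F 0 = 1"
    and F: "fps_deriv F = Abs_fps (\<lambda>n. a (Suc n)) * F"
  defines "G \<equiv> \<lambda>m::monom. \<Prod>i\<in>Poly_Mapping.keys m. fps_nth F (lkp m i)"
  shows "of_nat (mdeg m) * G m =
    (\<Sum>n\<in>{1..mdeg m}. \<Sum>i | n \<le> lkp m i. a n * G (m - Poly_Mapping.single i n))"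
proof -
  let ?K = "Poly_Mapping.keys m"
  have G: "G m' = (\<Prod>i\<in>?K. fps_nth F (lkp m' i))" if "Poly_Mapping.keys m' \<subseteq> ?K" for m'
    unfolding G_def using that by (intro prod.mono_neutral_left) (auto simp: in_keys_iff F0)
  have rec: "of_nat n * fps_nth F n = (\<Sum>k\<in>{1..n}. a k * fps_nth F (n - k))" for n
  proof (cases n)
    case (Suc n')
    have "of_nat n * fps_nth F n = fps_nth (fps_deriv F) n'"
      by (simp add: Suc)
    also have "\<dots> = (\<Sum>k\<in>{0..n'}. a (Suc k) * fps_nth F (n' - k))"
      unfolding F by (simp add: fps_mult_nth)
    also have "\<dots> = (\<Sum>k\<in>{1..n}. a k * fps_nth F (n - k))"
      by (rule sum.reindex_bij_witness[of _ "\<lambda>k. k - 1" Suc]) (auto simp: Suc)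
    finally show ?thesis .
  qed simp
  have fin: "finite {i. n \<le> lkp m i}" if "n \<in> {1..mdeg m}" for n
    using that by (intro finite_le_lookup) auto
  have "(\<Sum>n\<in>{1..mdeg m}. \<Sum>i | n \<le> lkp m i. a n * G (m - Poly_Mapping.single i n)) =
     (\<Sum>(n, i)\<in>(SIGMA n:{1..mdeg m}. {i. n \<le> lkp m i}). a n * G (m - Poly_Mapping.single i n))"
    using fin by (intro sum.Sigma) auto
  also have "\<dots> = (\<Sum>(i, n)\<in>(SIGMA i:?K. {1..lkp m i}). a n * G (m - Poly_Mapping.single i n))"
    by (rule sum.reindex_bij_witness[of _ "\<lambda>(i, n). (n, i)" "\<lambda>(n, i). (i, n)"])
       (auto simp: in_keys_iff intro: order_trans[OF _ lookup_le_mdeg])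
  also have "\<dots> = (\<Sum>i\<in>?K. \<Sum>n\<in>{1..lkp m i}. a n * G (m - Poly_Mapping.single i n))"
    by (rule sum.Sigma[symmetric]) auto
  also have "\<dots> = (\<Sum>i\<in>?K. of_nat (lkp m i) * G m)"
  proof (rule sum.cong[OF refl])
    fix i assume i: "i \<in> ?K"
    let ?R = "\<Prod>j\<in>?K - {i}. fps_nth F (lkp m j)"
    have eq: "G (m - Poly_Mapping.single i n) = fps_nth F (lkp m i - n) * ?R" for n
    proof -
      have "G (m - Poly_Mapping.single i n) = (\<Prod>j\<in>?K. fps_nth F (lkp (m - Poly_Mapping.single i n) j))"
        by (rule G) (auto simp: in_keys_iff lookup_minus)
      also have "\<dots> = fps_nth F (lkp (m - Poly_Mapping.single i n) i) * (\<Prod>j\<in>?K - {i}. fps_nth F (lkp (m - Poly_Mapping.single i n) j))"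
        using i by (intro prod.remove) auto
      also have "(\<Prod>j\<in>?K - {i}. fps_nth F (lkp (m - Poly_Mapping.single i n) j)) = ?R"
        by (intro prod.cong refl) (auto simp: lookup_minus lookup_single)
      finally show ?thesis by (simp add: lookup_minus)
    qed
    have "(\<Sum>n\<in>{1..lkp m i}. a n * G (m - Poly_Mapping.single i n)) =
       (\<Sum>n\<in>{1..lkp m i}. a n * fps_nth F (lkp m i - n)) * ?R"
      unfolding sum_distrib_right eq by (simp only: mult.assoc)
    also have "\<dots> = of_nat (lkp m i) * (fps_nth F (lkp m i) * ?R)"
      by (simp only: mult.assoc flip: rec)
    also have "fps_nth F (lkp m i) * ?R = G m"
      unfolding G_def using i by (intro prod.remove[symmetric]) auto
    finally show "(\<Sum>n\<in>{1..lkp m i}. a n * G (m - Poly_Mapping.single i n)) = of_nat (lkp m i) * G m" .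
  qed
  also have "\<dots> = of_nat (mdeg m) * G m"
    by (simp add: mdeg_def sum_distrib_right)
  finally show ?thesis by simp
qed

text \<open>The assumptions say that F is the exponential of the sum of a_n y^n / n. In
  characteristic zero Euler's recursion determines every coefficient of positive degree from those
  of smaller degree, so its two solutions agree.\<close>

lemma p_exp_eq_prod:
  fixes F :: "qt fps"
  assumes F0: "fps_nth F 0 = 1"
    and F: "fps_deriv F = Abs_fps (\<lambda>n. a (Suc n)) * F"
  shows "p_exp a m = (\<Prod>i\<in>Poly_Mapping.keys m. fps_nth F (lkp m i))"
proof (induction "mdeg m" arbitrary: m rule: less_induct)
  case less
  show ?case
  proof (cases "mdeg m = 0")
    case True
    then show ?thesis by (simp add: p_exp_0)
  next
    case False
    have "of_nat (mdeg m) * p_exp a m =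
      of_nat (mdeg m) * (\<Prod>i\<in>Poly_Mapping.keys m. fps_nth F (lkp m i))"
      unfolding p_exp_euler[of m a] prod_coeff_euler[OF F0 F, of m]
      by (intro sum.cong refl arg_cong2[of _ _ _ _ "(*)"] less) (auto simp: mdeg_diff_single)
    then show ?thesis using False by simp
  qed
qed

section \<open>Rational power series\<close>

lemma mcoeff_fps_in_var: "mcoeff (fps_in_var j f) m =
    (if Poly_Mapping.keys m \<subseteq> {j} then fps_nth f (lkp m j) else 0)"
  by (simp add: fps_in_var_def)

lemma keys_subset_singleton: "Poly_Mapping.keys m \<subseteq> {j} \<longleftrightarrow> m = Poly_Mapping.single j (lkp m j)" for m :: monom
proof
  assume "Poly_Mapping.keys m \<subseteq> {j}"
  then show "m = Poly_Mapping.single j (lkp m j)"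
    by (intro poly_mapping_eqI) (auto simp: lookup_single when_def in_keys_iff subset_iff)
qed (metis empty_subsetI keys_single subset_refl)

lemma keys_monom_add: "Poly_Mapping.keys (a + b) = Poly_Mapping.keys a \<union> Poly_Mapping.keys b" for a b :: monom
  by (auto simp: in_keys_iff lookup_add)

lemma fps_in_var_mult: "fps_in_var j (f * g) = fps_in_var j f * fps_in_var j g" for f g :: "'a::comm_ring_1 fps"
proof (rule mfps_eqI)
  fix m :: monom
  have R: "mcoeff (fps_in_var j f * fps_in_var j g) m =
    (\<Sum>(a, b)\<in>{(a, b). a + b = m}. mcoeff (fps_in_var j f) a * mcoeff (fps_in_var j g) b)"
    by (simp add: mcoeff_mult)
  show "mcoeff (fps_in_var j (f * g)) m = mcoeff (fps_in_var j f * fps_in_var j g) m"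
  proof (cases "Poly_Mapping.keys m \<subseteq> {j}")
    case True
    have "mcoeff (fps_in_var j (f * g)) m = (\<Sum>i\<in>{0..lkp m j}. fps_nth f i * fps_nth g (lkp m j - i))"
      using True by (simp add: mcoeff_fps_in_var fps_mult_nth)
    also have "\<dots> = mcoeff (fps_in_var j f * fps_in_var j g) m"
      unfolding R
    proof (rule sum.reindex_bij_witness[of _ "\<lambda>(a, b). lkp a j" "\<lambda>i. (Poly_Mapping.single j i, Poly_Mapping.single j (lkp m j - i))"], goal_cases)
      case (2 i)
      then show ?case using True by (simp add: keys_subset_singleton flip: single_add)
    next
      case (3 x)
      obtain a b where x: "x = (a, b)" by fastforce
      with 3 True have "Poly_Mapping.keys a \<subseteq> {j}" "Poly_Mapping.keys b \<subseteq> {j}" "lkp m j - lkp a j = lkp b j"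
        by (auto simp: keys_monom_add lookup_add)
      then show ?case using x unfolding keys_subset_singleton by simp
    qed (auto simp: lookup_add mcoeff_fps_in_var)
    finally show ?thesis .
  next
    case False
    then show ?thesis unfolding R
      by (subst sum.neutral) (auto simp: mcoeff_fps_in_var keys_monom_add)
  qed
qed

lemma fps_in_var_1: "fps_in_var j 1 = (1 :: 'a::comm_ring_1 mfps)"
  by (rule mfps_eqI) (auto simp: mcoeff_fps_in_var keys_subset_singleton)

lemma fps_in_var_prod: "fps_in_var j (prod f A) = (\<Prod>x\<in>A. fps_in_var j (f x))" for f :: "_ \<Rightarrow> 'a::comm_ring_1 fps"
  by (induction A rule: infinite_finite_induct) (auto simp: fps_in_var_1 fps_in_var_mult)

lemma mcoeff_prod_fps_in_var:
  fixes f :: "'a::comm_ring_1 fps"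
  shows "mcoeff (\<Prod>j<N. fps_in_var j f) m =
    (if Poly_Mapping.keys m \<subseteq> {..<N} then \<Prod>j<N. fps_nth f (lkp m j) else 0)"
proof (induction N arbitrary: m)
  case 0
  then show ?case by (auto intro!: poly_mapping_eqI simp: in_keys_iff)
next
  case (Suc N)
  let ?P = "\<Prod>j<N. fps_in_var j f"
  \<comment> \<open>The only contributing splitting of m gives the whole power of variable N to the
    last factor, because the first N factors do not involve that variable.\<close>
  let ?s = "Poly_Mapping.single N (lkp m N)"
  have s: "?s + (m - ?s) = m" by (rule single_add_diff) simp
  have "mcoeff (\<Prod>j<Suc N. fps_in_var j f) m = (\<Sum>(a, b)\<in>{(a, b). a + b = m}. mcoeff ?P a * mcoeff (fps_in_var N f) b)"
    by (simp add: mcoeff_mult)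
  also have "\<dots> = (\<Sum>(a, b)\<in>{(m - ?s, ?s)}. mcoeff ?P a * mcoeff (fps_in_var N f) b)"
  proof (rule sum.mono_neutral_right[OF finite_monom_splittings])
    show "{(m - ?s, ?s)} \<subseteq> {(a, b). a + b = m}" using s by (simp add: add.commute)
    show "\<forall>x\<in>{(a, b). a + b = m} - {(m - ?s, ?s)}. (case x of (a, b) \<Rightarrow> mcoeff ?P a * mcoeff (fps_in_var N f) b) = 0"
    proof
      fix x assume x: "x \<in> {(a, b). a + b = m} - {(m - ?s, ?s)}"
      obtain a b where ab: "x = (a, b)" by fastforce
      then have m: "m = a + b" and ne: "(a, b) \<noteq> (m - ?s, ?s)" using x by auto
      have "mcoeff ?P a * mcoeff (fps_in_var N f) b = 0"
      proof (rule ccontr)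
        assume nz: "mcoeff ?P a * mcoeff (fps_in_var N f) b \<noteq> 0"
        then have a: "Poly_Mapping.keys a \<subseteq> {..<N}" and b: "Poly_Mapping.keys b \<subseteq> {N}"
          by (auto simp: Suc.IH mcoeff_fps_in_var split: if_splits)
        have "lkp a N = 0" using a by (auto simp: in_keys_iff subset_iff)
        then have "b = ?s"
          using b unfolding keys_subset_singleton m by (simp add: lookup_add)
        then show False using ne m by (metis add_diff_cancel_right')
      qed
      then show "(case x of (a, b) \<Rightarrow> mcoeff ?P a * mcoeff (fps_in_var N f) b) = 0" by (simp add: ab)
    qed
  qed
  also have "\<dots> = (if Poly_Mapping.keys m \<subseteq> {..<Suc N} then \<Prod>j<Suc N. fps_nth f (lkp m j) else 0)"
  proof -
    have k: "Poly_Mapping.keys (m - ?s) \<subseteq> {..<N} \<longleftrightarrow> Poly_Mapping.keys m \<subseteq> {..<Suc N}"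
      by (auto simp: in_keys_iff subset_iff lookup_minus lookup_single when_def less_Suc_eq)
    have "(\<Prod>j<N. fps_nth f (lkp (m - ?s) j)) = (\<Prod>j<N. fps_nth f (lkp m j))"
      by (intro prod.cong refl) (auto simp: lookup_minus lookup_single)
    then show ?thesis by (simp add: Suc.IH k mcoeff_fps_in_var)
  qed
  finally show ?case .
qed

text \<open>Rationality in the variables \<open>y\<^sub>j = 1 / u\<^sub>j\<close>.\<close>

definition rational_mfps :: "nat \<Rightarrow> 'a::comm_ring_1 mfps \<Rightarrow> bool" where
  "rational_mfps N h \<longleftrightarrow> (\<exists>a\<in>mpoly_in N. \<exists>b\<in>mpoly_in N. b \<noteq> 0 \<and> of_mpoly b * h = of_mpoly a)"

lemma rational_mfps_of_mpoly: "a \<in> mpoly_in N \<Longrightarrow> rational_mfps N (of_mpoly a)" for a :: "'a::comm_ring_1 mpoly"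
  unfolding rational_mfps_def by (rule bexI[of _ a], rule bexI[of _ 1]) (auto simp: of_mpoly_hom mpoly_in_hom)

lemma rational_mfps_mult:
  fixes g h :: "'a::idom mfps"
  assumes "rational_mfps N g" "rational_mfps N h"
  shows "rational_mfps N (g * h)"
proof -
  obtain a b c d where *: "a \<in> mpoly_in N" "b \<in> mpoly_in N" "b \<noteq> 0" "of_mpoly b * g = of_mpoly a"
    "c \<in> mpoly_in N" "d \<in> mpoly_in N" "d \<noteq> 0" "of_mpoly d * h = of_mpoly c"
    using assms unfolding rational_mfps_def by blast
  have "of_mpoly (b * d) * (g * h) = (of_mpoly b * g) * (of_mpoly d * h)"
    by (simp add: of_mpoly_mult mult_ac)
  then have "of_mpoly (b * d) * (g * h) = of_mpoly (a * c)" using * by (simp add: of_mpoly_mult)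
  then show ?thesis unfolding rational_mfps_def using * mpoly_in_hom(4) no_zero_divisors by metis
qed

lemma rational_mfps_add:
  fixes g h :: "'a::idom mfps"
  assumes "rational_mfps N g" "rational_mfps N h"
  shows "rational_mfps N (g + h)"
proof -
  obtain a b c d where *: "a \<in> mpoly_in N" "b \<in> mpoly_in N" "b \<noteq> 0" "of_mpoly b * g = of_mpoly a"
    "c \<in> mpoly_in N" "d \<in> mpoly_in N" "d \<noteq> 0" "of_mpoly d * h = of_mpoly c"
    using assms unfolding rational_mfps_def by blast
  have "of_mpoly (b * d) * (g + h) = (of_mpoly b * g) * of_mpoly d + (of_mpoly d * h) * of_mpoly b"
    by (simp add: of_mpoly_mult algebra_simps)
  then have "of_mpoly (b * d) * (g + h) = of_mpoly (a * d + c * b)" using * by (simp add: of_mpoly_mult of_mpoly_hom)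
  moreover have "a * d + c * b \<in> mpoly_in N" "b * d \<in> mpoly_in N" using * by (auto intro: mpoly_in_hom)
  ultimately show ?thesis unfolding rational_mfps_def using * no_zero_divisors by metis
qed

lemma mpoly_const_in: "mpoly_const c \<in> mpoly_in N"
  by (auto simp: mpoly_const_def mpoly_in_def)

lemma rational_mfps_const: "rational_mfps N (mfps_const (c :: 'a::idom))"
  using rational_mfps_of_mpoly[OF mpoly_const_in[of c N]]
  by (simp add: mpoly_const_def of_mpoly_single mfps_const_eq_monom)

lemma rational_mfps_sum:
  "(\<And>x. x \<in> A \<Longrightarrow> rational_mfps N (f x)) \<Longrightarrow> rational_mfps N (sum f A)" for f :: "_ \<Rightarrow> 'a::idom mfps"
proof (induction A rule: infinite_finite_induct)
  case (insert x A)
  then show ?case by (simp add: rational_mfps_add)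
qed (use rational_mfps_of_mpoly[OF mpoly_in_hom(1)] in \<open>auto simp: of_mpoly_hom\<close>)

lemma rational_mfps_prod:
  "(\<And>x. x \<in> A \<Longrightarrow> rational_mfps N (f x)) \<Longrightarrow> rational_mfps N (prod f A)" for f :: "_ \<Rightarrow> 'a::idom mfps"
proof (induction A rule: infinite_finite_induct)
  case (insert x A)
  then show ?case by (simp add: rational_mfps_mult)
qed (use rational_mfps_of_mpoly[OF mpoly_in_hom(2)] in \<open>auto simp: of_mpoly_hom\<close>)

definition linear_fps :: "'a::comm_ring_1 \<Rightarrow> 'a fps" where
  "linear_fps c = 1 - fps_const c * fps_X"

definition geometric_fps :: "'a::comm_ring_1 \<Rightarrow> 'a fps" where
  "geometric_fps c = Abs_fps (\<lambda>n. c ^ n)"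

lemma linear_geometric_fps: "linear_fps c * geometric_fps c = 1"
proof (rule fps_ext)
  fix n
  show "fps_nth (linear_fps c * geometric_fps c) n = fps_nth 1 n"
    by (cases n) (auto simp: linear_fps_def geometric_fps_def left_diff_distrib mult.assoc)
qed

lemma fps_in_var_linear:
  "fps_in_var j (linear_fps c) = of_mpoly (1 - Poly_Mapping.single (Poly_Mapping.single j 1) c)"
proof (rule mfps_eqI)
  fix m :: monom
  show "mcoeff (fps_in_var j (linear_fps c)) m = mcoeff (of_mpoly (1 - Poly_Mapping.single (Poly_Mapping.single j 1) c)) m"
  proof (cases "Poly_Mapping.keys m \<subseteq> {j}")
    case True
    then obtain k where m: "m = Poly_Mapping.single j k" unfolding keys_subset_singleton by blast
    have "Poly_Mapping.single j k = 0 \<longleftrightarrow> k = 0" "Poly_Mapping.single j (Suc 0) = Poly_Mapping.single j k \<longleftrightarrow> k = 1"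
      by (metis lookup_single_eq lookup_zero single_zero) (metis lookup_single_eq One_nat_def)
    then show ?thesis unfolding m
      by (auto simp: mcoeff_fps_in_var linear_fps_def lookup_minus lookup_one lookup_single when_def)
  next
    case False
    then have "m \<noteq> 0" "m \<noteq> Poly_Mapping.single j 1" by auto
    then show ?thesis using False
      by (simp add: mcoeff_fps_in_var lookup_minus lookup_one lookup_single when_def)
  qed
qed

lemma linear_mpoly_in: "j < N \<Longrightarrow> 1 - Poly_Mapping.single (Poly_Mapping.single j 1) c \<in> mpoly_in N" for c :: "'a::comm_ring_1"
proof -
  assume j: "j < N"
  have "1 - Poly_Mapping.single (Poly_Mapping.single j 1) c = 1 + Poly_Mapping.single (Poly_Mapping.single j 1) (- c)"
    by (simp add: single_uminus)
  also have "\<dots> \<in> mpoly_in N"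
    by (rule mpoly_in_hom(3)[OF mpoly_in_hom(2)]) (use j in \<open>auto simp: mpoly_in_def\<close>)
  finally show ?thesis .
qed

lemma rational_mfps_linear: "j < N \<Longrightarrow> rational_mfps N (fps_in_var j (linear_fps c))" for c :: "'a::idom"
  unfolding fps_in_var_linear by (intro rational_mfps_of_mpoly linear_mpoly_in)

lemma rational_mfps_geometric: "j < N \<Longrightarrow> rational_mfps N (fps_in_var j (geometric_fps c))" for c :: "'a::idom"
proof -
  assume j: "j < N"
  define b :: "'a mpoly" where "b = 1 - Poly_Mapping.single (Poly_Mapping.single j 1) c"
  have "of_mpoly b * fps_in_var j (geometric_fps c) = fps_in_var j (linear_fps c * geometric_fps c)"
    unfolding b_def fps_in_var_linear[symmetric] by (rule fps_in_var_mult[symmetric])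
  also have "\<dots> = 1" by (simp only: linear_geometric_fps fps_in_var_1)
  finally have 1: "of_mpoly b * fps_in_var j (geometric_fps c) = of_mpoly 1" by (simp add: of_mpoly_hom)
  then have "b \<noteq> 0" by (auto simp: of_mpoly_hom)
  moreover have "b \<in> mpoly_in N" unfolding b_def using j by (rule linear_mpoly_in)
  ultimately show ?thesis unfolding rational_mfps_def using 1 mpoly_in_hom(2) by blast
qed

text \<open>\<open>reverse_mpoly N D b\<close> is \<open>(u\<^sub>1 \<dots> u\<^sub>N)^D b(1/u\<^sub>1, \<dots>, 1/u\<^sub>N)\<close>, for \<open>b\<close> of degree at most \<open>D\<close> in each variable.\<close>

definition box_monom :: "nat \<Rightarrow> nat \<Rightarrow> monom" where
  "box_monom N D = (\<Sum>i<N. Poly_Mapping.single i D)"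

lemma lookup_box_monom: "lkp (box_monom N D) i = (if i < N then D else 0)"
  by (auto simp: box_monom_def lookup_sum lookup_single when_def)

definition reverse_mpoly :: "nat \<Rightarrow> nat \<Rightarrow> 'a::comm_monoid_add mpoly \<Rightarrow> 'a mpoly" where
  "reverse_mpoly N D b = (\<Sum>m\<in>Poly_Mapping.keys b. Poly_Mapping.single (box_monom N D - m) (lkp b m))"

text \<open>Inside the box the truncated subtraction of exponents is exact, so reversal loses no
  terms. The bound also forces the support into the first N variables.\<close>

definition bounded_mpoly :: "nat \<Rightarrow> nat \<Rightarrow> 'a::zero mpoly \<Rightarrow> bool" where
  "bounded_mpoly N D b \<longleftrightarrow> (\<forall>m\<in>Poly_Mapping.keys b. \<forall>i. lkp m i \<le> lkp (box_monom N D) i)"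

text \<open>Stated for all large D because numerator and denominator must be reversed in the same
  box.\<close>

lemma bounded_mpoly_exists: "b \<in> mpoly_in N \<Longrightarrow> \<exists>D0. \<forall>D\<ge>D0. bounded_mpoly N D b"
proof -
  assume b: "b \<in> mpoly_in N"
  have "lkp m i \<le> lkp (box_monom N D) i" if "D \<ge> Max (insert 0 (mdeg ` Poly_Mapping.keys b))" "m \<in> Poly_Mapping.keys b" for D m i
  proof (cases "i < N")
    case True
    have "lkp m i \<le> mdeg m" by (rule lookup_le_mdeg)
    also have "\<dots> \<le> Max (insert 0 (mdeg ` Poly_Mapping.keys b))" using that by (intro Max_ge) auto
    also have "\<dots> \<le> D" by (rule that(1))
    finally show ?thesis using True by (simp add: lookup_box_monom)
  next
    case False
    then have "i \<notin> Poly_Mapping.keys m" using b that(2) unfolding mpoly_in_def by blast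
    then show ?thesis by (simp add: in_keys_iff)
  qed
  then show ?thesis unfolding bounded_mpoly_def by blast
qed

lemma box_diff_diff:
  fixes m B :: monom
  assumes "\<And>i. lkp m i \<le> lkp B i"
  shows "B - (B - m) = m" "(B - m) + m = B"
  using assms by (auto intro!: poly_mapping_eqI simp: lookup_minus lookup_add)

lemma lookup_reverse_mpoly:
  assumes b: "bounded_mpoly N D b" and m: "\<And>i. lkp m i \<le> lkp (box_monom N D) i"
  shows "lkp (reverse_mpoly N D b) (box_monom N D - m) = lkp b m"
proof -
  let ?B = "box_monom N D"
  have inj: "?B - m' = ?B - m \<longleftrightarrow> m' = m" if "m' \<in> Poly_Mapping.keys b" for m'
    using box_diff_diff(1)[of m' ?B] box_diff_diff(1)[of m ?B] b m that unfolding bounded_mpoly_def by metis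
  have "lkp (reverse_mpoly N D b) (?B - m) = (\<Sum>m'\<in>Poly_Mapping.keys b. if m' = m then lkp b m' else 0)"
    unfolding reverse_mpoly_def lookup_sum by (intro sum.cong refl) (simp add: lookup_single when_def inj)
  also have "\<dots> = lkp b m" by (simp add: in_keys_iff)
  finally show ?thesis .
qed

lemma keys_reverse_mpoly:
  assumes b: "bounded_mpoly N D b"
  shows "Poly_Mapping.keys (reverse_mpoly N D b) = (\<lambda>m. box_monom N D - m) ` Poly_Mapping.keys b"
proof
  show "Poly_Mapping.keys (reverse_mpoly N D b) \<subseteq> (\<lambda>m. box_monom N D - m) ` Poly_Mapping.keys b"
    unfolding reverse_mpoly_def by (rule order_trans[OF Poly_Mapping.keys_sum]) (auto split: if_splits)
  show "(\<lambda>m. box_monom N D - m) ` Poly_Mapping.keys b \<subseteq> Poly_Mapping.keys (reverse_mpoly N D b)"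
    using lookup_reverse_mpoly[OF b] b by (auto simp: in_keys_iff bounded_mpoly_def)
qed

lemma reverse_mpoly_in:
  assumes b: "bounded_mpoly N D b"
  shows "reverse_mpoly N D b \<in> mpoly_in N"
  unfolding mpoly_in_def
proof safe
  fix m i assume "m \<in> Poly_Mapping.keys (reverse_mpoly N D b)" and i: "i \<in> Poly_Mapping.keys m"
  then obtain m' where "m = box_monom N D - m'" using keys_reverse_mpoly[OF b] by auto
  then show "i < N" using i by (auto simp: in_keys_iff lookup_minus lookup_box_monom split: if_splits)
qed

text \<open>The reversed polynomial times h(1/u) is the box monomial times (b h)(1/u), so its
  coefficient at e is that of b h at the box exponent minus e. Since e is an arbitrary integer
  function, this difference may be negative or have infinite support; the coefficient is then
  0.\<close>

lemma laurent_product_reverse: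
  fixes b :: "'a::comm_ring_1 mpoly"
  assumes b: "bounded_mpoly N D b"
  shows "laurent_product (reverse_mpoly N D b) h e =
    (if \<exists>k. \<forall>i. int (lkp k i) = int (lkp (box_monom N D) i) - e i
     then mcoeff (of_mpoly b * h) (THE k. \<forall>i. int (lkp k i) = int (lkp (box_monom N D) i) - e i) else 0)"
proof -
  let ?B = "box_monom N D"
  have le: "lkp m i \<le> lkp ?B i" if "m \<in> Poly_Mapping.keys b" for m i
    using b that by (simp add: bounded_mpoly_def)
  have inj: "inj_on (\<lambda>m. ?B - m) (Poly_Mapping.keys b)"
    using box_diff_diff(1)[of _ ?B] le by (metis inj_onI)
  have eq: "int (lkp (?B - m) i) - int (lkp n i) = e i \<longleftrightarrow> int (lkp (m + n) i) = int (lkp ?B i) - e i"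
    if "m \<in> Poly_Mapping.keys b" for m n i
    using le[OF that, of i] by (auto simp: lookup_minus lookup_add of_nat_diff)
  have L: "laurent_product (reverse_mpoly N D b) h e =
    (\<Sum>m\<in>Poly_Mapping.keys b. \<Sum>n | \<forall>i. int (lkp (m + n) i) = int (lkp ?B i) - e i. lkp b m * mcoeff h n)"
    unfolding laurent_product_def keys_reverse_mpoly[OF b] sum.reindex[OF inj]
    by (intro sum.cong refl) (auto simp: eq lookup_reverse_mpoly[OF b] le)
  show ?thesis
  proof (cases "\<exists>k. \<forall>i. int (lkp k i) = int (lkp ?B i) - e i")
    case False
    then have E: "{n. \<forall>i. int (lkp (m + n) i) = int (lkp ?B i) - e i} = {}" for m by blast
    show ?thesis unfolding if_not_P[OF False] L E by simp
  next
    case True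
    then obtain k where k: "\<And>i. int (lkp k i) = int (lkp ?B i) - e i" by blast
    have the: "(THE k. \<forall>i. int (lkp k i) = int (lkp ?B i) - e i) = k"
      by (rule the_equality) (auto intro!: poly_mapping_eqI simp: k simp flip: k)
    have "(\<forall>i. int (lkp (m + n) i) = int (lkp ?B i) - e i) \<longleftrightarrow> m + n = k" for m n
      by (auto intro!: poly_mapping_eqI simp: k simp flip: k)
    then have "laurent_product (reverse_mpoly N D b) h e = (\<Sum>m\<in>Poly_Mapping.keys b. \<Sum>n | m + n = k. lkp b m * mcoeff h n)"
      unfolding L by simp
    also have "\<dots> = (\<Sum>(m, n)\<in>(SIGMA m:Poly_Mapping.keys b. {n. m + n = k}). lkp b m * mcoeff h n)"
    proof (rule sum.Sigma)
      show "\<forall>m\<in>Poly_Mapping.keys b. finite {n. m + n = k}"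
      proof
        fix m
        have "{n. m + n = k} \<subseteq> {k - m}" by auto
        then show "finite {n. m + n = k}" by (rule finite_subset) simp
      qed
    qed simp
    also have "\<dots> = (\<Sum>(m, n)\<in>{(m, n). m + n = k}. lkp b m * mcoeff h n)"
      by (rule sum.mono_neutral_left[OF finite_monom_splittings]) (auto simp: in_keys_iff)
    also have "\<dots> = mcoeff (of_mpoly b * h) k" by (simp add: mcoeff_mult)
    finally show ?thesis unfolding if_P[OF True] the .
  qed
qed

text \<open>With a common box, both Laurent products are given by the same formula in
  \<open>of_mpoly b * h\<close> and \<open>of_mpoly a * 1\<close>, which are equal.\<close>

lemma rational_mfps_imp_expansion:
  assumes "rational_mfps N h"
  shows "\<exists>r\<in>rational_functions N. is_expansion_of h r"
proof -
  obtain a b where ab: "a \<in> mpoly_in N" "b \<in> mpoly_in N" "b \<noteq> 0" "of_mpoly b * h = of_mpoly a"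
    using assms unfolding rational_mfps_def by blast
  obtain D where a: "bounded_mpoly N D a" and b: "bounded_mpoly N D b"
    using bounded_mpoly_exists[OF ab(1)] bounded_mpoly_exists[OF ab(2)] by (metis nat_le_linear)
  let ?a = "reverse_mpoly N D a" and ?b = "reverse_mpoly N D b"
  have "laurent_product ?b h = laurent_product ?a 1"
    by (rule ext) (simp only: laurent_product_reverse[OF a] laurent_product_reverse[OF b] ab(4) mult_1_right)
  moreover have "?b \<noteq> 0"
    using keys_reverse_mpoly[OF b] ab(3) by (metis image_is_empty keys_eq_empty keys_zero)
  moreover have "Fract ?a ?b \<in> rational_functions N"
    using reverse_mpoly_in[OF a] reverse_mpoly_in[OF b] calculation(2) unfolding rational_functions_def by blast
  ultimately show ?thesis unfolding is_expansion_of_def by blast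
qed

section \<open>The kernels as rational functions\<close>

text \<open>The relation f'/f = g without division; it turns products into sums.\<close>

definition has_log_deriv :: "'a::comm_ring_1 fps \<Rightarrow> 'a fps \<Rightarrow> bool" where
  "has_log_deriv f g \<longleftrightarrow> fps_deriv f = g * f"

lemma has_log_deriv_mult:
  "has_log_deriv f a \<Longrightarrow> has_log_deriv g b \<Longrightarrow> has_log_deriv (f * g) (a + b)"
  by (simp add: has_log_deriv_def algebra_simps)

lemma has_log_deriv_prod:
  "(\<And>x. x \<in> A \<Longrightarrow> has_log_deriv (f x) (g x)) \<Longrightarrow> has_log_deriv (prod f A) (sum g A)"
  by (induction A rule: infinite_finite_induct)
     (auto intro!: has_log_deriv_mult, auto simp: has_log_deriv_def)

lemma has_log_deriv_inverse:
  fixes f :: "'a::field fps"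
  assumes "has_log_deriv f a" "fps_nth f 0 \<noteq> 0"
  shows "has_log_deriv (inverse f) (- a)"
proof -
  have "inverse f * f = 1" using assms(2) by (rule inverse_mult_eq_1)
  then show ?thesis
    using assms unfolding has_log_deriv_def fps_inverse_deriv[OF assms(2)]
    by (simp add: power2_eq_square mult_ac)
qed

lemma has_log_deriv_geometric: "has_log_deriv (geometric_fps c) (fps_const c * geometric_fps c)"
  unfolding has_log_deriv_def
proof (rule fps_ext)
  fix n
  have "(\<Sum>i=0..n. c ^ i * c ^ (n - i)) = of_nat (n + 1) * c ^ n"
    by (simp flip: power_add)
  then show "fps_nth (fps_deriv (geometric_fps c)) n = fps_nth (fps_const c * geometric_fps c * geometric_fps c) n"
    unfolding mult.assoc fps_mult_left_const_nth by (simp add: geometric_fps_def fps_mult_nth algebra_simps)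
qed

lemma has_log_deriv_linear: "has_log_deriv (linear_fps c) (- (fps_const c * geometric_fps c))"
proof -
  have "- (fps_const c * geometric_fps c) * linear_fps c = - (fps_const c * (linear_fps c * geometric_fps c))"
    by (simp add: mult_ac)
  then show ?thesis
    unfolding has_log_deriv_def linear_geometric_fps by (simp add: linear_fps_def)
qed

lemma q_pochhammer_inf_0: "fps_nth q_pochhammer_inf 0 = 1"
  by (simp add: q_pochhammer_inf_def fps_compose_nth)

text \<open>In the logarithm of the series the term z^m carries the denominator m (1 - q^m);
  differentiation cancels the m.\<close>

lemma has_log_deriv_q_pochhammer_inf:
  "has_log_deriv q_pochhammer_inf (- Abs_fps (\<lambda>n. 1 / (1 - q ^ Suc n)))"
proof -
  let ?c = "- Abs_fps (\<lambda>m. if m = 0 then 0 else 1 / (of_nat m * (1 - q ^ m))) :: qt fps"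
  have "fps_deriv q_pochhammer_inf = (fps_deriv (fps_exp 1) oo ?c) * fps_deriv ?c"
    unfolding q_pochhammer_inf_def by (rule fps_compose_deriv) simp
  moreover have "fps_deriv ?c = - Abs_fps (\<lambda>n. 1 / (1 - q ^ Suc n))"
  proof (rule fps_ext)
    fix n
    have "(of_nat (Suc n) :: qt) \<noteq> 0" by (rule of_nat_neq_0)
    then show "fps_nth (fps_deriv ?c) n = fps_nth (- Abs_fps (\<lambda>n. 1 / (1 - q ^ Suc n))) n"
      by (simp del: of_nat_Suc power_Suc)
  qed
  ultimately show ?thesis
    by (simp add: has_log_deriv_def q_pochhammer_inf_def mult.commute)
qed

text \<open>The exponents for which \<open>p_exp\<close> is the kernel K_\<nu>: the value of p_n
  divided by the Macdonald factor of a part n.\<close>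

definition mac_spec :: "nat list \<Rightarrow> nat \<Rightarrow> qt" where
  "mac_spec \<nu> n = spec \<nu> n * ((1 - t ^ n) / (1 - q ^ n))"

text \<open>Rows are numbered from \<open>0\<close>, columns from \<open>1\<close>.\<close>

definition cells :: "nat list \<Rightarrow> (nat \<times> nat) set" where
  "cells \<nu> = (SIGMA i:{..<length \<nu>}. {1..part \<nu> i})"

definition cell_weight :: "nat \<times> nat \<Rightarrow> qt" where
  "cell_weight = (\<lambda>(i, k). t ^ i * inverse q ^ k)"

text \<open>With rows numbered from 0, the cell (i, k) contributes (1 - t^(i+1) q^(-k) y) / (1 - t^i
  q^(-k) y), the denominator being expanded as a geometric series.\<close>

definition cell_product :: "nat list \<Rightarrow> qt fps" where
  "cell_product \<nu> = (\<Prod>c\<in>cells \<nu>. linear_fps (t * cell_weight c) * geometric_fps (cell_weight c))"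

lemma sum_inverse_powers:
  fixes x :: "'a::field"
  assumes "x \<noteq> 0" "x \<noteq> 1"
  shows "(inverse x ^ v - 1) / (1 - x) = (\<Sum>k\<in>{1..v}. inverse x ^ k)"
proof -
  have "(1 - x) * (\<Sum>k\<in>{1..v}. inverse x ^ k) = inverse x ^ v - 1"
    using assms(1) by (induction v) (auto simp: algebra_simps)
  then show ?thesis using assms(2) by (metis eq_iff_diff_eq_0 nonzero_mult_div_cancel_left)
qed

text \<open>The factor 1 - t^n cancels the denominator of the constant in \<open>spec\<close>,
  leaving the term of the empty partition. In row i, the difference of the powers of the actual and
  the empty point, divided by 1 - q^n, is a finite geometric sum over the columns.\<close>

lemma mac_spec_cells:
  assumes n: "0 < n"
  shows "mac_spec \<nu> n = 1 / (1 - q ^ n) + (\<Sum>c\<in>cells \<nu>. cell_weight c ^ n - (t * cell_weight c) ^ n)"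
proof -
  have tn: "1 - t ^ n \<noteq> 0" and qn: "1 - q ^ n \<noteq> 0" "q ^ n \<noteq> 0" "q ^ n \<noteq> 1"
    using t_power_neq_1[OF n] q_power_neq_1[OF n] q_neq_0 by auto
  have x: "X_point \<nu> i ^ n - t ^ (i * n) = t ^ (i * n) * (inverse (q ^ n) ^ part \<nu> i - 1)" for i
  proof -
    have "inverse q ^ (part \<nu> i * n) = inverse (q ^ n) ^ part \<nu> i"
      by (simp add: power_inverse mult.commute flip: power_mult)
    then show ?thesis
      by (simp add: X_point_def power_mult_distrib right_diff_distrib mult.commute flip: power_mult)
  qed
  have 1: "1 / (1 - t ^ n) * ((1 - t ^ n) / (1 - q ^ n)) = 1 / (1 - q ^ n)" using tn by simp
  have "mac_spec \<nu> n = (\<Sum>i<length \<nu>. t ^ (i * n) * (1 - t ^ n) * ((inverse (q ^ n) ^ part \<nu> i - 1) / (1 - q ^ n))) + 1 / (1 - q ^ n)"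
    unfolding mac_spec_def spec_def x distrib_right sum_distrib_right 1
    by (intro arg_cong2[of _ _ _ _ "(+)"] sum.cong refl) (simp add: mult_ac)
  also have "(\<Sum>i<length \<nu>. t ^ (i * n) * (1 - t ^ n) * ((inverse (q ^ n) ^ part \<nu> i - 1) / (1 - q ^ n)))
    = (\<Sum>i<length \<nu>. \<Sum>k\<in>{1..part \<nu> i}. cell_weight (i, k) ^ n - (t * cell_weight (i, k)) ^ n)"
  proof (rule sum.cong[OF refl])
    fix i
    have "t ^ (i * n) * (1 - t ^ n) * inverse (q ^ n) ^ k = cell_weight (i, k) ^ n - (t * cell_weight (i, k)) ^ n" for k
    proof -
      have "inverse (q ^ n) ^ k = (inverse q ^ k) ^ n"
        by (simp add: power_inverse mult.commute flip: power_mult)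
      then show ?thesis by (simp add: cell_weight_def power_mult_distrib power_mult algebra_simps)
    qed
    then show "t ^ (i * n) * (1 - t ^ n) * ((inverse (q ^ n) ^ part \<nu> i - 1) / (1 - q ^ n))
      = (\<Sum>k\<in>{1..part \<nu> i}. cell_weight (i, k) ^ n - (t * cell_weight (i, k)) ^ n)"
      unfolding sum_inverse_powers[OF qn(2,3)] sum_distrib_left by (intro sum.cong refl) simp
  qed
  also have "\<dots> = (\<Sum>c\<in>cells \<nu>. cell_weight c ^ n - (t * cell_weight c) ^ n)"
    unfolding cells_def by (subst sum.Sigma) (auto intro!: sum.cong)
  finally show ?thesis by simp
qed

lemma cell_product_0: "fps_nth (cell_product \<nu>) 0 = 1"
proof -
  have "fps_nth (prod f A) 0 = (\<Prod>x\<in>A. fps_nth (f x) 0)" for f :: "nat \<times> nat \<Rightarrow> qt fps" and A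
    by (induction A rule: infinite_finite_induct) auto
  then show ?thesis by (simp add: cell_product_def linear_fps_def geometric_fps_def)
qed

lemma has_log_deriv_cell_product:
  "has_log_deriv (cell_product \<nu> * inverse q_pochhammer_inf) (Abs_fps (\<lambda>n. mac_spec \<nu> (Suc n)))"
proof -
  have "has_log_deriv (cell_product \<nu> * inverse q_pochhammer_inf)
    ((\<Sum>c\<in>cells \<nu>. - (fps_const (t * cell_weight c) * geometric_fps (t * cell_weight c)) + fps_const (cell_weight c) * geometric_fps (cell_weight c))
     + - (- Abs_fps (\<lambda>n. 1 / (1 - q ^ Suc n))))"
    unfolding cell_product_def
    by (intro has_log_deriv_mult has_log_deriv_prod has_log_deriv_inverse has_log_deriv_linear
        has_log_deriv_geometric has_log_deriv_q_pochhammer_inf) (simp add: q_pochhammer_inf_0)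
  also have "(\<Sum>c\<in>cells \<nu>. - (fps_const (t * cell_weight c) * geometric_fps (t * cell_weight c)) + fps_const (cell_weight c) * geometric_fps (cell_weight c))
     + - (- Abs_fps (\<lambda>n. 1 / (1 - q ^ Suc n))) = Abs_fps (\<lambda>n. mac_spec \<nu> (Suc n))"
    by (rule fps_ext) (simp add: mac_spec_cells fps_sum_nth geometric_fps_def)
  finally show ?thesis .
qed

lemma p_exp_mac_spec:
  "p_exp (mac_spec \<nu>) m = (\<Prod>i\<in>Poly_Mapping.keys m. fps_nth (cell_product \<nu> * inverse q_pochhammer_inf) (lkp m i))"
  using has_log_deriv_cell_product[of \<nu>]
  by (intro p_exp_eq_prod) (simp_all add: has_log_deriv_def cell_product_0 q_pochhammer_inf_0)

text \<open>The one-variable factor has constant term 1, so the product over the support of m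
  extends to all j < N.\<close>

lemma restrict_p_exp:
  "restrict_vars N (Abs_mfps (p_exp (mac_spec \<nu>))) =
    (\<Prod>j<N. fps_in_var j (cell_product \<nu> * inverse q_pochhammer_inf))"
proof (rule mfps_eqI)
  fix m
  let ?F = "cell_product \<nu> * inverse q_pochhammer_inf"
  have "(\<Prod>i\<in>Poly_Mapping.keys m. fps_nth ?F (lkp m i)) = (\<Prod>i<N. fps_nth ?F (lkp m i))"
    if "Poly_Mapping.keys m \<subseteq> {..<N}"
    using that by (intro prod.mono_neutral_left) (auto simp: in_keys_iff cell_product_0 q_pochhammer_inf_0)
  then show "mcoeff (restrict_vars N (Abs_mfps (p_exp (mac_spec \<nu>)))) m = mcoeff (\<Prod>j<N. fps_in_var j ?F) m"
    by (simp add: restrict_vars_def p_exp_mac_spec mcoeff_prod_fps_in_var)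
qed

lemma mac_weight_quotient:
  assumes "0 \<notin> set \<sigma>"
  shows "spec_list \<nu> \<sigma> / mac_weight \<sigma> = prod_list (map (mac_spec \<nu>) \<sigma>) / of_nat (z_part \<sigma>)"
    and "mac_weight \<sigma> \<noteq> 0"
proof -
  have nz: "1 - q ^ k \<noteq> 0" "1 - t ^ k \<noteq> 0" if "k \<in> set \<sigma>" for k
    using that assms q_power_neq_1[of k] t_power_neq_1[of k] by (cases "k = 0"; auto)+
  have nzw: "(\<Prod>k\<leftarrow>\<sigma>. (1 - q ^ k) / (1 - t ^ k)) \<noteq> 0"
    using nz by (auto simp: prod_list_zero_iff)
  then show "mac_weight \<sigma> \<noteq> 0"
    using z_part_pos[OF assms] by (auto simp: mac_weight_def)
  have "spec_list \<nu> \<sigma> = prod_list (map (mac_spec \<nu>) \<sigma>) * (\<Prod>k\<leftarrow>\<sigma>. (1 - q ^ k) / (1 - t ^ k))"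
    using nz unfolding spec_list_def mac_spec_def by (induction \<sigma>) (simp_all add: mult_ac)
  then show "spec_list \<nu> \<sigma> / mac_weight \<sigma> = prod_list (map (mac_spec \<nu>) \<sigma>) / of_nat (z_part \<sigma>)"
    using nzw by (simp add: mac_weight_def)
qed

text \<open>A relation between power sum coefficients with constants independent of \<sigma> is an
  identity of series, because each coefficient at a monomial involves only the finitely many
  \<sigma> of its degree.\<close>

lemma Sym_hat_eq_p_exp_combination:
  assumes f: "f \<in> Sym_hat"
    and C: "\<And>\<sigma>. is_partition \<sigma> \<Longrightarrow> mac_weight \<sigma> * p_coeffs f \<sigma> = (\<Sum>\<nu>\<in>A. C \<nu> * spec_list \<nu> \<sigma>)"
  shows "f = (\<Sum>\<nu>\<in>A. mfps_const (C \<nu>) * Abs_mfps (p_exp (mac_spec \<nu>)))"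
proof (rule mfps_eqI)
  fix m
  let ?S = "{\<sigma>. is_partition \<sigma> \<and> sum_list \<sigma> = mdeg m}"
  have "p_coeffs f \<sigma> = (\<Sum>\<nu>\<in>A. C \<nu> * (prod_list (map (mac_spec \<nu>) \<sigma>) / of_nat (z_part \<sigma>)))" if "\<sigma> \<in> ?S" for \<sigma>
  proof -
    have \<sigma>: "is_partition \<sigma>" "0 \<notin> set \<sigma>" using that by (auto simp: is_partition_def)
    have "p_coeffs f \<sigma> = (\<Sum>\<nu>\<in>A. C \<nu> * spec_list \<nu> \<sigma>) / mac_weight \<sigma>"
      using C[OF \<sigma>(1)] mac_weight_quotient(2)[OF \<sigma>(2)] by (metis nonzero_mult_div_cancel_left)
    then show ?thesis
      by (simp add: sum_divide_distrib mac_weight_quotient(1)[OF \<sigma>(2)] flip: times_divide_eq_right)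
  qed
  then have "mcoeff f m = (\<Sum>\<sigma>\<in>?S. \<Sum>\<nu>\<in>A. C \<nu> * (prod_list (map (mac_spec \<nu>) \<sigma>) / of_nat (z_part \<sigma>) * mcoeff (power_sums \<sigma>) m))"
    unfolding p_expansionD[OF p_expansion_p_coeffs[OF f], of m]
    by (intro sum.cong refl) (simp add: sum_distrib_right mult.assoc)
  also have "\<dots> = (\<Sum>\<nu>\<in>A. C \<nu> * p_exp (mac_spec \<nu>) m)"
    by (subst sum.swap) (simp only: p_exp_def sum_distrib_left)
  finally show "mcoeff f m = mcoeff (\<Sum>\<nu>\<in>A. mfps_const (C \<nu>) * Abs_mfps (p_exp (mac_spec \<nu>))) m"
    by (simp add: mcoeff_sum)
qed

lemma restrict_vars_sum:
  "restrict_vars N (\<Sum>x\<in>A. mfps_const (c x) * f x) = (\<Sum>x\<in>A. mfps_const (c x) * restrict_vars N (f x))"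
  by (rule mfps_eqI) (simp add: restrict_vars_def mcoeff_sum)

lemma rational_mfps_cell_product: "rational_mfps N (\<Prod>j<N. fps_in_var j (cell_product \<nu>))"
  unfolding cell_product_def fps_in_var_prod fps_in_var_mult
  by (intro rational_mfps_prod rational_mfps_mult rational_mfps_linear rational_mfps_geometric) auto

lemma rational_H_tilde:
  assumes I: "interpolation_functions P I" and H: "dual_functions I H" and \<mu>: "is_partition \<mu>"
  shows "rational_mfps N (H_tilde N (H \<mu>))"
proof -
  let ?A = "parts_le (sum_list \<mu>)"
  obtain C where "\<And>\<sigma>. is_partition \<sigma> \<Longrightarrow> mac_weight \<sigma> * p_coeffs (H \<mu>) \<sigma> = (\<Sum>\<nu>\<in>?A. C \<nu> * spec_list \<nu> \<sigma>)"
    using dual_functions_span[OF I H \<mu>] by blast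
  moreover have "H \<mu> \<in> Sym_hat" using H \<mu> by (simp add: dual_functions_def)
  ultimately have Heq: "H \<mu> = (\<Sum>\<nu>\<in>?A. mfps_const (C \<nu>) * Abs_mfps (p_exp (mac_spec \<nu>)))"
    by (rule Sym_hat_eq_p_exp_combination[rotated])
  \<comment> \<open>The cancellation takes place in each variable separately, where the series with
    constant term 1 is invertible.\<close>
  have cancel: "(\<Prod>j<N. fps_in_var j (cell_product \<nu> * inverse q_pochhammer_inf)) * (\<Prod>j<N. fps_in_var j q_pochhammer_inf) =
      (\<Prod>j<N. fps_in_var j (cell_product \<nu>))" for \<nu>
  proof -
    have "inverse q_pochhammer_inf * q_pochhammer_inf = 1"
      by (rule inverse_mult_eq_1) (simp add: q_pochhammer_inf_0)
    then have "cell_product \<nu> * inverse q_pochhammer_inf * q_pochhammer_inf = cell_product \<nu>"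
      by (simp add: mult.assoc)
    then show ?thesis by (simp only: prod.distrib[symmetric] fps_in_var_mult[symmetric])
  qed
  have "H_tilde N (H \<mu>) = (\<Sum>\<nu>\<in>?A. mfps_const (C \<nu>) * (\<Prod>j<N. fps_in_var j (cell_product \<nu>)))"
    unfolding H_tilde_def Heq restrict_vars_sum restrict_p_exp sum_distrib_right mult.assoc cancel ..
  then show ?thesis
    by (simp add: rational_mfps_sum rational_mfps_mult rational_mfps_const rational_mfps_cell_product)
qed

theorem corollary5p3:
  fixes P I H :: "nat list \<Rightarrow> qt mfps" and N :: nat and \<mu> :: "nat list"
  assumes "macdonald_functions P"
    and "interpolation_functions P I"
    and "dual_functions I H"
    and "N \<ge> 1"
    and "is_partition \<mu>"
  shows "\<exists>r\<in>rational_functions N. is_expansion_of (H_tilde N (H \<mu>)) r"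
  using rational_mfps_imp_expansion[OF rational_H_tilde[OF assms(2,3,5)]] .

end
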